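(* Let $\mathcal{R}$ be a regular category. Every object $r$ in its relations po-category $\mathbb{R}\mathrm{el}_{\mathcal{R}}$ has a unique adjoint monoid structure.
   Context: A po-category is a poset-enriched category. For a regular category $\mathcal{R}$, the relations po-category $\mathbb{R}\mathrm{el}_{\mathcal{R}}$ has the same objects; morphisms $r\to s$ are subobjects $x\subseteq r\times s$ ordered by inclusion, composed by pulling back over the middle object and taking the image in the product of the outer objects; it is symmetric monoidal with $r_1\otimes r_2=r_1\times r_2$ and unit $I$ the terminal object of $\mathcal{R}$. An adjoint (commutative) monoid in a symmetric monoidal po-category is a commutative monoid object $(c,\mu\colon c\otimes c\to c,\eta\colon I\to c)$ such that $\mu$ and $\eta$ are right adjoints (a morphism $R\colon d\to c$ is a right adjoint if there is $L\colon c\to d$ with $\mathrm{id}_c\le L;R$ and $R;L\le\mathrm{id}_d$, where $f;g$ means first $f$, then $g$). *)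

theory Defs
  imports Main
begin

section \<open>Categories\<close>

text \<open>Composition is written in diagrammatic order: \<open>f \<Zsemi> g\<close> is first \<open>f\<close>, then \<open>g\<close>.\<close>

record ('o, 'm) category_data =
  Obj :: "'o set"
  Arr :: "'m set"
  Dom :: "'m \<Rightarrow> 'o"
  Cod :: "'m \<Rightarrow> 'o"
  ident :: "'o \<Rightarrow> 'm"  ("\<one>\<index>")
  comp :: "'m \<Rightarrow> 'm \<Rightarrow> 'm"  (infixl "\<Zsemi>\<index>" 70)

definition hom :: "('o, 'm, 'x) category_data_scheme \<Rightarrow> 'o \<Rightarrow> 'o \<Rightarrow> 'm set" where
  "hom C a b = {f \<in> Arr C. Dom C f = a \<and> Cod C f = b}"

locale category =
  fixes C :: "('o, 'm, 'x) category_data_scheme" (structure)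
  assumes Dom_Obj: "f \<in> Arr C \<Longrightarrow> Dom C f \<in> Obj C"
    and Cod_Obj: "f \<in> Arr C \<Longrightarrow> Cod C f \<in> Obj C"
    and ident_hom: "a \<in> Obj C \<Longrightarrow> \<one> a \<in> hom C a a"
    and comp_hom: "f \<in> hom C a b \<Longrightarrow> g \<in> hom C b c \<Longrightarrow> f \<Zsemi> g \<in> hom C a c"
    and ident_left: "f \<in> hom C a b \<Longrightarrow> \<one> a \<Zsemi> f = f"
    and ident_right: "f \<in> hom C a b \<Longrightarrow> f \<Zsemi> \<one> b = f"
    and comp_assoc:
      "f \<in> hom C a b \<Longrightarrow> g \<in> hom C b c \<Longrightarrow> h \<in> hom C c d \<Longrightarrow> (f \<Zsemi> g) \<Zsemi> h = f \<Zsemi> (g \<Zsemi> h)"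


section \<open>Limits, coequalizers and regular categories\<close>

definition is_functor ::
  "('i, 'j, 'x) category_data_scheme \<Rightarrow> ('o, 'm, 'y) category_data_scheme
    \<Rightarrow> ('i \<Rightarrow> 'o) \<Rightarrow> ('j \<Rightarrow> 'm) \<Rightarrow> bool" where
  "is_functor J C Fo Fa \<longleftrightarrow>
     (\<forall>i \<in> Obj J. Fo i \<in> Obj C) \<and>
     (\<forall>u \<in> Arr J. Fa u \<in> hom C (Fo (Dom J u)) (Fo (Cod J u))) \<and>
     (\<forall>i \<in> Obj J. Fa (\<one>\<^bsub>J\<^esub> i) = \<one>\<^bsub>C\<^esub> (Fo i)) \<and>
     (\<forall>u \<in> Arr J. \<forall>v \<in> Arr J. Cod J u = Dom J v \<longrightarrow> Fa (u \<Zsemi>\<^bsub>J\<^esub> v) = Fa u \<Zsemi>\<^bsub>C\<^esub> Fa v)"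

definition is_cone ::
  "('i, 'j, 'x) category_data_scheme \<Rightarrow> ('o, 'm, 'y) category_data_scheme
    \<Rightarrow> ('i \<Rightarrow> 'o) \<Rightarrow> ('j \<Rightarrow> 'm) \<Rightarrow> 'o \<Rightarrow> ('i \<Rightarrow> 'm) \<Rightarrow> bool" where
  "is_cone J C Fo Fa l \<pi> \<longleftrightarrow>
     l \<in> Obj C \<and>
     (\<forall>i \<in> Obj J. \<pi> i \<in> hom C l (Fo i)) \<and>
     (\<forall>u \<in> Arr J. \<pi> (Dom J u) \<Zsemi>\<^bsub>C\<^esub> Fa u = \<pi> (Cod J u))"

definition is_limit ::
  "('i, 'j, 'x) category_data_scheme \<Rightarrow> ('o, 'm, 'y) category_data_scheme
    \<Rightarrow> ('i \<Rightarrow> 'o) \<Rightarrow> ('j \<Rightarrow> 'm) \<Rightarrow> 'o \<Rightarrow> ('i \<Rightarrow> 'm) \<Rightarrow> bool" where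
  "is_limit J C Fo Fa l \<pi> \<longleftrightarrow>
     is_cone J C Fo Fa l \<pi> \<and>
     (\<forall>k \<chi>. is_cone J C Fo Fa k \<chi> \<longrightarrow>
        (\<exists>!h. h \<in> hom C k l \<and> (\<forall>i \<in> Obj J. h \<Zsemi>\<^bsub>C\<^esub> \<pi> i = \<chi> i)))"

text \<open>Every finite category is isomorphic to one whose objects and arrows are natural numbers,
  so it suffices to quantify over those. A category with finitely many arrows has finitely many
  objects.\<close>

definition has_finite_limits :: "('o, 'm, 'x) category_data_scheme \<Rightarrow> bool" where
  "has_finite_limits C \<longleftrightarrow>
     (\<forall>(J :: (nat, nat) category_data) Fo Fa.
        category J \<and> finite (Arr J) \<and> is_functor J C Fo Fa \<longrightarrow> (\<exists>l \<pi>. is_limit J C Fo Fa l \<pi>))"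

definition is_terminal :: "('o, 'm, 'x) category_data_scheme \<Rightarrow> 'o \<Rightarrow> bool" where
  "is_terminal C t \<longleftrightarrow> t \<in> Obj C \<and> (\<forall>a \<in> Obj C. \<exists>!f. f \<in> hom C a t)"

definition is_product ::
  "('o, 'm, 'x) category_data_scheme \<Rightarrow> 'o \<Rightarrow> 'o \<Rightarrow> 'o \<Rightarrow> 'm \<Rightarrow> 'm \<Rightarrow> bool" where
  "is_product C a b p \<pi>\<^sub>1 \<pi>\<^sub>2 \<longleftrightarrow>
     p \<in> Obj C \<and> \<pi>\<^sub>1 \<in> hom C p a \<and> \<pi>\<^sub>2 \<in> hom C p b \<and>
     (\<forall>d. \<forall>f \<in> hom C d a. \<forall>g \<in> hom C d b.
        \<exists>!h. h \<in> hom C d p \<and> h \<Zsemi>\<^bsub>C\<^esub> \<pi>\<^sub>1 = f \<and> h \<Zsemi>\<^bsub>C\<^esub> \<pi>\<^sub>2 = g)"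

definition is_pullback ::
  "('o, 'm, 'x) category_data_scheme \<Rightarrow> 'm \<Rightarrow> 'm \<Rightarrow> 'm \<Rightarrow> 'm \<Rightarrow> bool" where
  "is_pullback C f g p q \<longleftrightarrow>
     f \<in> Arr C \<and> g \<in> Arr C \<and> Cod C f = Cod C g \<and>
     p \<in> Arr C \<and> q \<in> Arr C \<and> Dom C p = Dom C q \<and> Cod C p = Dom C f \<and> Cod C q = Dom C g \<and>
     p \<Zsemi>\<^bsub>C\<^esub> f = q \<Zsemi>\<^bsub>C\<^esub> g \<and>
     (\<forall>d. \<forall>u \<in> hom C d (Dom C f). \<forall>v \<in> hom C d (Dom C g). u \<Zsemi>\<^bsub>C\<^esub> f = v \<Zsemi>\<^bsub>C\<^esub> g \<longrightarrow>
        (\<exists>!h. h \<in> hom C d (Dom C p) \<and> h \<Zsemi>\<^bsub>C\<^esub> p = u \<and> h \<Zsemi>\<^bsub>C\<^esub> q = v))"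

definition is_coequalizer ::
  "('o, 'm, 'x) category_data_scheme \<Rightarrow> 'm \<Rightarrow> 'm \<Rightarrow> 'm \<Rightarrow> bool" where
  "is_coequalizer C f g e \<longleftrightarrow>
     f \<in> Arr C \<and> g \<in> Arr C \<and> Dom C f = Dom C g \<and> Cod C f = Cod C g \<and>
     e \<in> Arr C \<and> Dom C e = Cod C f \<and> f \<Zsemi>\<^bsub>C\<^esub> e = g \<Zsemi>\<^bsub>C\<^esub> e \<and>
     (\<forall>d. \<forall>h \<in> hom C (Cod C f) d. f \<Zsemi>\<^bsub>C\<^esub> h = g \<Zsemi>\<^bsub>C\<^esub> h \<longrightarrow>
        (\<exists>!k. k \<in> hom C (Cod C e) d \<and> e \<Zsemi>\<^bsub>C\<^esub> k = h))"

definition regular_epi :: "('o, 'm, 'x) category_data_scheme \<Rightarrow> 'm \<Rightarrow> bool" where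
  "regular_epi C e \<longleftrightarrow> (\<exists>f g. is_coequalizer C f g e)"

locale regular_category = category C for C :: "('o, 'm, 'x) category_data_scheme" (structure) +
  assumes finite_limits: "has_finite_limits C"
    and kernel_pair_coequalizer: "is_pullback C f f p q \<Longrightarrow> \<exists>e. is_coequalizer C p q e"
    and regular_epi_stable: "is_pullback C e g p q \<Longrightarrow> regular_epi C e \<Longrightarrow> regular_epi C q"


section \<open>Subobjects and images\<close>

definition monic :: "('o, 'm, 'x) category_data_scheme \<Rightarrow> 'm \<Rightarrow> bool" where
  "monic C m \<longleftrightarrow> m \<in> Arr C \<and>
     (\<forall>d. \<forall>f \<in> hom C d (Dom C m). \<forall>g \<in> hom C d (Dom C m). f \<Zsemi>\<^bsub>C\<^esub> m = g \<Zsemi>\<^bsub>C\<^esub> m \<longrightarrow> f = g)"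

definition factors_through :: "('o, 'm, 'x) category_data_scheme \<Rightarrow> 'm \<Rightarrow> 'm \<Rightarrow> bool" where
  "factors_through C f m \<longleftrightarrow> (\<exists>h \<in> hom C (Dom C f) (Dom C m). h \<Zsemi>\<^bsub>C\<^esub> m = f)"

text \<open>A subobject is an equivalence class of monomorphisms with a common codomain.\<close>

definition subobject_of :: "('o, 'm, 'x) category_data_scheme \<Rightarrow> 'm \<Rightarrow> 'm set" where
  "subobject_of C m =
     {n. monic C n \<and> Cod C n = Cod C m \<and> factors_through C m n \<and> factors_through C n m}"

definition subobjects :: "('o, 'm, 'x) category_data_scheme \<Rightarrow> 'o \<Rightarrow> 'm set set" where
  "subobjects C a = {subobject_of C m | m. monic C m \<and> Cod C m = a}"

definition subobject_le :: "('o, 'm, 'x) category_data_scheme \<Rightarrow> 'm set \<Rightarrow> 'm set \<Rightarrow> bool" where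
  "subobject_le C X Y \<longleftrightarrow> (\<exists>x \<in> X. \<exists>y \<in> Y. factors_through C x y)"

text \<open>In a regular category the factorization of \<open>f\<close> as a regular epimorphism followed by a
  monomorphism exists and is unique up to isomorphism, so the monomorphisms occurring in such
  factorizations form a single subobject.\<close>

definition image_subobject :: "('o, 'm, 'x) category_data_scheme \<Rightarrow> 'm \<Rightarrow> 'm set" where
  "image_subobject C f =
     {m. monic C m \<and> (\<exists>e. regular_epi C e \<and> Cod C e = Dom C m \<and> e \<Zsemi>\<^bsub>C\<^esub> m = f)}"


section \<open>Adjoint monoids in symmetric monoidal po-categories\<close>

record ('o, 'm) sm_po_category_data = "('o, 'm) category_data" +
  le :: "'m \<Rightarrow> 'm \<Rightarrow> bool"  (infix "\<preceq>\<index>" 50)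
  tensor_obj :: "'o \<Rightarrow> 'o \<Rightarrow> 'o"
  tensor :: "'m \<Rightarrow> 'm \<Rightarrow> 'm"  (infixr "\<otimes>\<index>" 75)
  unit_obj :: "'o"
  associator :: "'o \<Rightarrow> 'o \<Rightarrow> 'o \<Rightarrow> 'm"  \<comment> \<open>\<open>(a \<otimes> b) \<otimes> c \<rightarrow> a \<otimes> (b \<otimes> c)\<close>\<close>
  left_unitor :: "'o \<Rightarrow> 'm"  \<comment> \<open>\<open>I \<otimes> a \<rightarrow> a\<close>\<close>
  right_unitor :: "'o \<Rightarrow> 'm"  \<comment> \<open>\<open>a \<otimes> I \<rightarrow> a\<close>\<close>
  symmetry :: "'o \<Rightarrow> 'o \<Rightarrow> 'm"  \<comment> \<open>\<open>a \<otimes> b \<rightarrow> b \<otimes> a\<close>\<close>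

definition comm_monoid_object ::
  "('o, 'm, 'x) sm_po_category_data_scheme \<Rightarrow> 'o \<Rightarrow> 'm \<Rightarrow> 'm \<Rightarrow> bool" where
  "comm_monoid_object M c \<mu> \<eta> \<longleftrightarrow>
     c \<in> Obj M \<and> \<mu> \<in> hom M (tensor_obj M c c) c \<and> \<eta> \<in> hom M (unit_obj M) c \<and>
     (\<mu> \<otimes>\<^bsub>M\<^esub> \<one>\<^bsub>M\<^esub> c) \<Zsemi>\<^bsub>M\<^esub> \<mu> = associator M c c c \<Zsemi>\<^bsub>M\<^esub> (\<one>\<^bsub>M\<^esub> c \<otimes>\<^bsub>M\<^esub> \<mu>) \<Zsemi>\<^bsub>M\<^esub> \<mu> \<and>
     (\<eta> \<otimes>\<^bsub>M\<^esub> \<one>\<^bsub>M\<^esub> c) \<Zsemi>\<^bsub>M\<^esub> \<mu> = left_unitor M c \<and>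
     (\<one>\<^bsub>M\<^esub> c \<otimes>\<^bsub>M\<^esub> \<eta>) \<Zsemi>\<^bsub>M\<^esub> \<mu> = right_unitor M c \<and>
     symmetry M c c \<Zsemi>\<^bsub>M\<^esub> \<mu> = \<mu>"

definition right_adjoint :: "('o, 'm, 'x) sm_po_category_data_scheme \<Rightarrow> 'm \<Rightarrow> bool" where
  "right_adjoint M R \<longleftrightarrow> R \<in> Arr M \<and>
     (\<exists>L \<in> hom M (Cod M R) (Dom M R).
        \<one>\<^bsub>M\<^esub> (Cod M R) \<preceq>\<^bsub>M\<^esub> L \<Zsemi>\<^bsub>M\<^esub> R \<and> R \<Zsemi>\<^bsub>M\<^esub> L \<preceq>\<^bsub>M\<^esub> \<one>\<^bsub>M\<^esub> (Dom M R))"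

definition adjoint_monoid ::
  "('o, 'm, 'x) sm_po_category_data_scheme \<Rightarrow> 'o \<Rightarrow> 'm \<Rightarrow> 'm \<Rightarrow> bool" where
  "adjoint_monoid M c \<mu> \<eta> \<longleftrightarrow>
     comm_monoid_object M c \<mu> \<eta> \<and> right_adjoint M \<mu> \<and> right_adjoint M \<eta>"


section \<open>The relations po-category\<close>

text \<open>The hom-sets and the monoidal structure of the relations po-category refer to particular
  products \<open>r \<times> s\<close> and a particular terminal object; these are supplied as a parameter \<open>P\<close>, about
  which nothing but the universal properties is assumed.\<close>

record ('o, 'm) products_data =
  prod :: "'o \<Rightarrow> 'o \<Rightarrow> 'o"
  proj1 :: "'o \<Rightarrow> 'o \<Rightarrow> 'm"
  proj2 :: "'o \<Rightarrow> 'o \<Rightarrow> 'm"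
  terminal :: "'o"

definition chosen_products ::
  "('o, 'm, 'x) category_data_scheme \<Rightarrow> ('o, 'm) products_data \<Rightarrow> bool" where
  "chosen_products C P \<longleftrightarrow>
     is_terminal C (terminal P) \<and>
     (\<forall>a \<in> Obj C. \<forall>b \<in> Obj C. is_product C a b (prod P a b) (proj1 P a b) (proj2 P a b))"

definition pairing ::
  "('o, 'm, 'x) category_data_scheme \<Rightarrow> ('o, 'm) products_data \<Rightarrow> 'm \<Rightarrow> 'm \<Rightarrow> 'm" where
  "pairing C P f g =
     (THE h. h \<in> hom C (Dom C f) (prod P (Cod C f) (Cod C g)) \<and>
        h \<Zsemi>\<^bsub>C\<^esub> proj1 P (Cod C f) (Cod C g) = f \<and> h \<Zsemi>\<^bsub>C\<^esub> proj2 P (Cod C f) (Cod C g) = g)"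

text \<open>A morphism \<open>r \<rightarrow> s\<close> is a triple \<open>(r, s, X)\<close> with \<open>X\<close> a subobject of \<open>r \<times> s\<close>. The triple is needed
  since different pairs of objects may have the same chosen product.\<close>

type_synonym ('o, 'm) rel = "'o \<times> 'o \<times> 'm set"

definition rel_graph ::
  "('o, 'm, 'x) category_data_scheme \<Rightarrow> ('o, 'm) products_data \<Rightarrow> 'm \<Rightarrow> ('o, 'm) rel" where
  "rel_graph C P f = (Dom C f, Cod C f, subobject_of C (pairing C P (\<one>\<^bsub>C\<^esub> (Dom C f)) f))"

text \<open>In the next two definitions all choices of representatives \<open>x\<close>, \<open>y\<close>, and of the pullback
  \<open>p\<close>, \<open>q\<close>, yield the same subobject, so each union is that subobject.\<close>

fun rel_comp ::
  "('o, 'm, 'x) category_data_scheme \<Rightarrow> ('o, 'm) products_data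
    \<Rightarrow> ('o, 'm) rel \<Rightarrow> ('o, 'm) rel \<Rightarrow> ('o, 'm) rel" where
  "rel_comp C P (r, s, X) (s', t, Y) = (r, t,
     \<Union>{image_subobject C (pairing C P (p \<Zsemi>\<^bsub>C\<^esub> x \<Zsemi>\<^bsub>C\<^esub> proj1 P r s) (q \<Zsemi>\<^bsub>C\<^esub> y \<Zsemi>\<^bsub>C\<^esub> proj2 P s' t)) | x y p q.
          x \<in> X \<and> y \<in> Y \<and> is_pullback C (x \<Zsemi>\<^bsub>C\<^esub> proj2 P r s) (y \<Zsemi>\<^bsub>C\<^esub> proj1 P s' t) p q})"

fun rel_tensor ::
  "('o, 'm, 'x) category_data_scheme \<Rightarrow> ('o, 'm) products_data
    \<Rightarrow> ('o, 'm) rel \<Rightarrow> ('o, 'm) rel \<Rightarrow> ('o, 'm) rel" where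
  "rel_tensor C P (r1, s1, X) (r2, s2, Y) = (prod P r1 r2, prod P s1 s2,
     \<Union>{let p = proj1 P (Dom C x) (Dom C y); q = proj2 P (Dom C x) (Dom C y) in
        subobject_of C
          (pairing C P
            (pairing C P (p \<Zsemi>\<^bsub>C\<^esub> x \<Zsemi>\<^bsub>C\<^esub> proj1 P r1 s1) (q \<Zsemi>\<^bsub>C\<^esub> y \<Zsemi>\<^bsub>C\<^esub> proj1 P r2 s2))
            (pairing C P (p \<Zsemi>\<^bsub>C\<^esub> x \<Zsemi>\<^bsub>C\<^esub> proj2 P r1 s1) (q \<Zsemi>\<^bsub>C\<^esub> y \<Zsemi>\<^bsub>C\<^esub> proj2 P r2 s2))) | x y.
          x \<in> X \<and> y \<in> Y})"

fun rel_le ::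
  "('o, 'm, 'x) category_data_scheme \<Rightarrow> ('o, 'm) rel \<Rightarrow> ('o, 'm) rel \<Rightarrow> bool" where
  "rel_le C (r, s, X) (r', s', Y) \<longleftrightarrow> r = r' \<and> s = s' \<and> subobject_le C X Y"

text \<open>The structure isomorphisms are the graphs of those of the cartesian monoidal structure
  of \<open>C\<close>.\<close>

definition Rel ::
  "('o, 'm, 'x) category_data_scheme \<Rightarrow> ('o, 'm) products_data
    \<Rightarrow> ('o, ('o, 'm) rel) sm_po_category_data" where
  "Rel C P = \<lparr>
     Obj = Obj C,
     Arr = {(r, s, X). r \<in> Obj C \<and> s \<in> Obj C \<and> X \<in> subobjects C (prod P r s)},
     Dom = (\<lambda>(r, s, X). r),
     Cod = (\<lambda>(r, s, X). s),
     ident = (\<lambda>r. rel_graph C P (\<one>\<^bsub>C\<^esub> r)),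
     comp = rel_comp C P,
     le = rel_le C,
     tensor_obj = prod P,
     tensor = rel_tensor C P,
     unit_obj = terminal P,
     associator = (\<lambda>a b c. rel_graph C P
       (pairing C P
         (proj1 P (prod P a b) c \<Zsemi>\<^bsub>C\<^esub> proj1 P a b)
         (pairing C P (proj1 P (prod P a b) c \<Zsemi>\<^bsub>C\<^esub> proj2 P a b) (proj2 P (prod P a b) c)))),
     left_unitor = (\<lambda>a. rel_graph C P (proj2 P (terminal P) a)),
     right_unitor = (\<lambda>a. rel_graph C P (proj1 P a (terminal P))),
     symmetry = (\<lambda>a b. rel_graph C P (pairing C P (proj2 P a b) (proj1 P a b)))\<rparr>"

end

(* Relations are handled through generalized elements: a relation X from r to s holds of a pair of
   arrows u : d -> r, v : d -> s if (u, v) factors through X, and X is determined by the pairs of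
   which it holds. Stability of regular epimorphisms makes composites behave existentially up to
   passing to a regular epimorphic cover of d, and membership in a relation descends along covers.
   The converses of the diagonal and of r -> 1 then form an adjoint monoid. Conversely let mu, eta
   be one. The unit of the adjunction makes eta total, so eta is the largest relation from 1 to r.
   If mu holds of ((x, y), g), then x = g and y = g by the unit laws; and the unit of the adjunction
   provides, locally, for each g some (x, y) with mu((x, y), g), which must then be (g, g). So mu is
   the converse of the diagonal. *)

theory Submission
  imports Defs
begin

text \<open>The obstacle is the form of \<open>rel_comp\<close> and \<open>rel_tensor\<close>: both
  are unions over all representatives, and the former also over all pullbacks, so that even being a
  morphism of \<open>Rel C P\<close> requires independence of these choices. Every single choice is
  shown to have the same generalized elements; extensionality then identifies all choices at once,
  without comparison maps between different pullbacks.

  Covers are unavoidable because an element of an image need not lift to the arrow whose image is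
  taken. Hence a composite supplies its middle element only on a cover. This is harmless whenever
  that element is forced to be the restriction of an arrow that already exists on the original
  domain, for then membership descends. It is forced in composites that begin with a graph or end
  with a converse graph, which covers all the monoid laws; it is forced for \<open>\<eta>\<close> by
  terminality, and for \<open>\<mu>\<close> by the unit laws.\<close>

context category
begin

section \<open>Typed calculus of arrows\<close>

lemma hom_iff:
  "f \<in> hom C a b \<longleftrightarrow> f \<in> Arr C \<and> Dom C f = a \<and> Cod C f = b \<and> a \<in> Obj C \<and> b \<in> Obj C"
  using Dom_Obj Cod_Obj unfolding hom_def by auto

lemma comp_simps:
  assumes "f \<in> Arr C" "g \<in> Arr C" "Cod C f = Dom C g"
  shows "f \<Zsemi> g \<in> Arr C" "Dom C (f \<Zsemi> g) = Dom C f" "Cod C (f \<Zsemi> g) = Cod C g"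
  using comp_hom[of f "Dom C f" "Cod C f" g "Cod C g"] assms unfolding hom_def by auto

lemma assoc:
  assumes "f \<in> Arr C" "g \<in> Arr C" "h \<in> Arr C" "Cod C f = Dom C g" "Cod C g = Dom C h"
  shows "(f \<Zsemi> g) \<Zsemi> h = f \<Zsemi> (g \<Zsemi> h)"
  using comp_assoc[of f "Dom C f" "Cod C f" g "Cod C g" h "Cod C h"] assms
  unfolding hom_def by auto

lemma ident_simps:
  assumes "a \<in> Obj C"
  shows "\<one> a \<in> Arr C" "Dom C (\<one> a) = a" "Cod C (\<one> a) = a"
  using ident_hom[OF assms] unfolding hom_def by auto

lemma ident_comp:
  assumes "f \<in> Arr C"
  shows "Dom C f = a \<Longrightarrow> \<one> a \<Zsemi> f = f" "Cod C f = b \<Longrightarrow> f \<Zsemi> \<one> b = f"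
  using assms ident_left[of f "Dom C f" "Cod C f"] ident_right[of f "Dom C f" "Cod C f"]
  unfolding hom_def by auto

lemmas arr_simps = comp_simps assoc ident_simps ident_comp

section \<open>Generalized elements of subobjects\<close>

lemma factors_through_iff:
  assumes "f \<in> hom C d a" "m \<in> hom C n a"
  shows "factors_through C f m \<longleftrightarrow> (\<exists>h \<in> hom C d n. h \<Zsemi> m = f)"
  using assms unfolding factors_through_def by (simp add: hom_iff)

lemma factors_through_comp:
  assumes "f \<in> hom C d a" "m \<in> hom C n a" "k \<in> hom C d' d" "factors_through C f m"
  shows "factors_through C (k \<Zsemi> f) m"
proof -
  obtain h where "h \<in> hom C d n" "h \<Zsemi> m = f"
    using assms(4) factors_through_iff[OF assms(1,2)] by blast
  moreover have "k \<Zsemi> f \<in> hom C d' a" using assms by (simp add: hom_iff arr_simps)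
  moreover have "(k \<Zsemi> h) \<Zsemi> m = k \<Zsemi> f" "k \<Zsemi> h \<in> hom C d' n"
    using calculation assms by (auto simp: hom_iff arr_simps)
  ultimately show ?thesis using factors_through_iff[of "k \<Zsemi> f" d' a m n] assms(2) by blast
qed

lemma factors_through_trans:
  assumes "f \<in> hom C d a" "m \<in> hom C n a" "n' \<in> hom C k a"
    "factors_through C f m" "factors_through C m n'"
  shows "factors_through C f n'"
proof -
  obtain h where h: "h \<in> hom C d n" "h \<Zsemi> m = f"
    using assms(4) factors_through_iff[OF assms(1,2)] by blast
  then show ?thesis using factors_through_comp[OF assms(2,3) h(1) assms(5)] by (simp only: h(2))
qed

lemma factors_through_refl:
  assumes "m \<in> hom C n a" shows "factors_through C m m"
proof -
  have "\<one> n \<in> hom C n n" "\<one> n \<Zsemi> m = m" using assms by (simp_all add: hom_iff arr_simps)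
  then show ?thesis unfolding factors_through_iff[OF assms assms] by blast
qed

lemma monic_hom: "monic C m \<Longrightarrow> m \<in> hom C (Dom C m) (Cod C m)"
  unfolding monic_def hom_def by auto

lemma monicD:
  assumes "monic C m" "f \<in> hom C d (Dom C m)" "g \<in> hom C d (Dom C m)" "f \<Zsemi> m = g \<Zsemi> m"
  shows "f = g"
  using assms unfolding monic_def by blast

text \<open>Quantifying over the members of the class avoids choosing a representative. For a
  genuine subobject any one representative decides, by \<open>subobject_member\<close>.\<close>

definition belongs :: "'m \<Rightarrow> 'm set \<Rightarrow> bool" where
  "belongs f X \<longleftrightarrow> (\<exists>x \<in> X. factors_through C f x)"

lemma belongs_subobject_of:
  assumes "monic C m" "f \<in> hom C d (Cod C m)"
  shows "belongs f (subobject_of C m) \<longleftrightarrow> factors_through C f m"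
proof
  assume "belongs f (subobject_of C m)"
  then obtain n where n: "monic C n" "Cod C n = Cod C m" "factors_through C n m"
      "factors_through C f n"
    unfolding belongs_def subobject_of_def by auto
  then show "factors_through C f m"
    using factors_through_trans[of f d "Cod C m" n "Dom C n" m "Dom C m"]
      assms monic_hom[of n] monic_hom[of m] by simp
next
  assume "factors_through C f m"
  moreover have "m \<in> subobject_of C m"
    using assms factors_through_refl[OF monic_hom] unfolding subobject_of_def by auto
  ultimately show "belongs f (subobject_of C m)" unfolding belongs_def by blast
qed

lemma subobjectE:
  assumes "X \<in> subobjects C a"
  obtains m where "monic C m" "Cod C m = a" "X = subobject_of C m" "m \<in> X"
proof -
  obtain m where m: "monic C m" "Cod C m = a" "X = subobject_of C m"
    using assms unfolding subobjects_def by blast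
  moreover have "m \<in> X"
    using m factors_through_refl[OF monic_hom] unfolding subobject_of_def by simp
  ultimately show thesis using that by blast
qed

lemma subobject_member:
  assumes "X \<in> subobjects C a" "x \<in> X"
  shows "monic C x" "x \<in> hom C (Dom C x) a"
    "f \<in> hom C d a \<Longrightarrow> belongs f X \<longleftrightarrow> factors_through C f x"
proof -
  obtain m where m: "monic C m" "Cod C m = a" "X = subobject_of C m"
    using assms subobjectE by metis
  then show x: "monic C x" "x \<in> hom C (Dom C x) a"
    using assms monic_hom[of x] unfolding subobject_of_def by auto
  assume f: "f \<in> hom C d a"
  have "factors_through C m x" using m assms unfolding subobject_of_def by auto
  then show "belongs f X \<longleftrightarrow> factors_through C f x"
    using belongs_subobject_of[of m f d] factors_through_trans[of f d a m "Dom C m" x "Dom C x"]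
      f m x assms(2) monic_hom[of m] unfolding belongs_def by auto
qed

text \<open>A Yoneda argument: a representative of \<open>X\<close> is itself a generalized element
  of \<open>X\<close>, and testing the right-hand side on it gives the factorization.\<close>

lemma subobject_le_iff:
  assumes "X \<in> subobjects C a" "Y \<in> subobjects C a"
  shows "subobject_le C X Y \<longleftrightarrow> (\<forall>d. \<forall>f \<in> hom C d a. belongs f X \<longrightarrow> belongs f Y)"
proof
  assume "subobject_le C X Y"
  then obtain x y where xy: "x \<in> X" "y \<in> Y" "factors_through C x y"
    unfolding subobject_le_def by blast
  note x = subobject_member[OF assms(1) xy(1)] and y = subobject_member[OF assms(2) xy(2)]
  show "\<forall>d. \<forall>f \<in> hom C d a. belongs f X \<longrightarrow> belongs f Y"
    using x(3) y(3) factors_through_trans[OF _ x(2) y(2) _ xy(3)] by simp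
next
  assume *: "\<forall>d. \<forall>f \<in> hom C d a. belongs f X \<longrightarrow> belongs f Y"
  obtain x where x: "x \<in> X" using assms subobjectE by metis
  have "belongs x X"
    using x factors_through_refl[OF subobject_member(2)[OF assms(1) x]]
    unfolding belongs_def by blast
  then show "subobject_le C X Y"
    using * x subobject_member(2)[OF assms(1) x] unfolding subobject_le_def belongs_def by blast
qed

text \<open>Testing on a representative of each side makes the two representatives factor through
  each other. They are then equivalent to the same monomorphisms, which gives equality of the
  classes as sets.\<close>

lemma subobject_eqI:
  assumes "X \<in> subobjects C a" "Y \<in> subobjects C a"
    and "\<And>d f. f \<in> hom C d a \<Longrightarrow> belongs f X \<longleftrightarrow> belongs f Y"
  shows "X = Y"
proof -
  obtain m where m: "monic C m" "Cod C m = a" "X = subobject_of C m" "m \<in> X"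
    using assms(1) subobjectE by metis
  obtain n where n: "monic C n" "Cod C n = a" "Y = subobject_of C n" "n \<in> Y"
    using assms(2) subobjectE by metis
  have mh: "m \<in> hom C (Dom C m) a" and nh: "n \<in> hom C (Dom C n) a"
    using m n monic_hom by metis+
  have mn: "factors_through C m n" "factors_through C n m"
    using assms(3)[OF mh] assms(3)[OF nh] factors_through_refl[OF mh] factors_through_refl[OF nh]
      m(4) n(4) subobject_member(3)[OF assms(1) m(4) nh] subobject_member(3)[OF assms(2) n(4) mh]
    unfolding belongs_def by blast+
  have "factors_through C m k \<and> factors_through C k m \<longleftrightarrow>
      factors_through C n k \<and> factors_through C k n" if "monic C k" "Cod C k = a" for k
  proof -
    have kh: "k \<in> hom C (Dom C k) a" using that monic_hom by metis
    show ?thesis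
      using factors_through_trans[OF mh nh kh] factors_through_trans[OF nh mh kh]
        factors_through_trans[OF kh mh nh] factors_through_trans[OF kh nh mh] mn by blast
  qed
  then show ?thesis unfolding m(3) n(3) subobject_of_def using m n by auto
qed

lemma subobject_of_subobjects: "monic C m \<Longrightarrow> subobject_of C m \<in> subobjects C (Cod C m)"
  unfolding subobjects_def by blast

section \<open>Regular epimorphisms and descent\<close>

lemma regular_epi_hom: "regular_epi C e \<Longrightarrow> e \<in> hom C (Dom C e) (Cod C e)"
  unfolding regular_epi_def is_coequalizer_def hom_def by auto

lemma coequalizer_factor:
  assumes "is_coequalizer C f g e" "e \<in> hom C d a" "h \<in> hom C d c" "f \<Zsemi> h = g \<Zsemi> h"
  obtains k where "k \<in> hom C a c" "e \<Zsemi> k = h"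
proof -
  have "Cod C f = d" "Cod C e = a"
    using assms(1,2) unfolding is_coequalizer_def hom_def by auto
  then have "\<exists>!k. k \<in> hom C a c \<and> e \<Zsemi> k = h"
    using assms(1,3,4) unfolding is_coequalizer_def by simp
  then show thesis using that by blast
qed

lemma coequalizer_epi:
  assumes "is_coequalizer C a b e" "u \<in> hom C (Cod C e) d" "v \<in> hom C (Cod C e) d"
    "e \<Zsemi> u = e \<Zsemi> v"
  shows "u = v"
proof -
  have *: "a \<in> Arr C" "b \<in> Arr C" "e \<in> Arr C" "Cod C a = Dom C e" "Cod C b = Dom C e"
      "a \<Zsemi> e = b \<Zsemi> e" "Dom C e = Cod C a"
    using assms(1) unfolding is_coequalizer_def by auto
  have "e \<Zsemi> u \<in> hom C (Cod C a) d"
    using * assms Cod_Obj[of a] by (simp add: hom_iff comp_simps)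
  moreover have "a \<Zsemi> (e \<Zsemi> u) = b \<Zsemi> (e \<Zsemi> u)"
    using * assms(2) by (simp add: hom_iff flip: assoc)
  ultimately have "\<exists>!k. k \<in> hom C (Cod C e) d \<and> e \<Zsemi> k = e \<Zsemi> u"
    using assms(1) unfolding is_coequalizer_def by blast
  then show ?thesis using assms by metis
qed

lemma regular_epi_cancel:
  assumes "regular_epi C e" "u \<in> hom C (Cod C e) d" "v \<in> hom C (Cod C e) d" "e \<Zsemi> u = e \<Zsemi> v"
  shows "u = v"
  using assms coequalizer_epi unfolding regular_epi_def by blast

text \<open>The trivial cover: a middle element that exists without passing to a cover still
  witnesses membership in a composite.\<close>

lemma regular_epi_ident:
  assumes "a \<in> Obj C" shows "regular_epi C (\<one> a)"
  unfolding regular_epi_def is_coequalizer_def using assms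
  by (intro exI[of _ "\<one> a"]) (auto simp: arr_simps hom_iff)

text \<open>The composite is a coequalizer of the same pair as \<open>e\<close>. This is what lets
  \<open>image_subobject\<close> contain every monomorphism equivalent to the one of a given
  factorization.\<close>

lemma regular_epi_comp_iso:
  assumes e: "regular_epi C e" "e \<in> hom C d a" and i: "i \<in> hom C a b" "j \<in> hom C b a"
    "i \<Zsemi> j = \<one> a" "j \<Zsemi> i = \<one> b"
  shows "regular_epi C (e \<Zsemi> i)"
proof -
  obtain f g where fg: "is_coequalizer C f g e" using e unfolding regular_epi_def by blast
  then have *: "f \<in> Arr C" "g \<in> Arr C" "Dom C f = Dom C g" "Cod C f = d" "Cod C g = d"
      "f \<Zsemi> e = g \<Zsemi> e" "Cod C f = Cod C g"
    using e(2) unfolding is_coequalizer_def hom_def by auto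
  have "\<exists>!k. k \<in> hom C b c \<and> (e \<Zsemi> i) \<Zsemi> k = h"
    if h: "h \<in> hom C d c" "f \<Zsemi> h = g \<Zsemi> h" for c h
  proof -
    obtain k where k: "k \<in> hom C a c" "e \<Zsemi> k = h"
      using coequalizer_factor[OF fg e(2) h] .
    have "i \<Zsemi> (j \<Zsemi> k) = k"
      using i k(1) by (simp add: hom_iff arr_simps flip: assoc)
    then have 1: "j \<Zsemi> k \<in> hom C b c \<and> (e \<Zsemi> i) \<Zsemi> (j \<Zsemi> k) = h"
      using e i k by (simp add: hom_iff arr_simps)
    have 2: "k' = j \<Zsemi> k" if k': "k' \<in> hom C b c" "(e \<Zsemi> i) \<Zsemi> k' = h" for k'
    proof -
      have "e \<Zsemi> (i \<Zsemi> k') = e \<Zsemi> k" using k' k e i by (simp add: hom_iff arr_simps)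
      then have "i \<Zsemi> k' = k"
        using regular_epi_cancel[OF e(1), of "i \<Zsemi> k'" c k] e i k k'
        by (simp add: hom_iff arr_simps)
      moreover have "(j \<Zsemi> i) \<Zsemi> k' = j \<Zsemi> (i \<Zsemi> k')"
        using i(1,2) k'(1) by (simp add: hom_iff assoc)
      ultimately show ?thesis using i k' by (simp add: hom_iff arr_simps)
    qed
    from 1 2 show ?thesis by blast
  qed
  moreover have "f \<Zsemi> (e \<Zsemi> i) = g \<Zsemi> (e \<Zsemi> i)"
    using * e i by (simp add: hom_iff flip: assoc)
  moreover have "e \<Zsemi> i \<in> Arr C" "Dom C (e \<Zsemi> i) = d" "Cod C (e \<Zsemi> i) = b"
    using e(2) i(1) by (simp_all add: hom_iff comp_simps)
  ultimately have "is_coequalizer C f g (e \<Zsemi> i)"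
    unfolding is_coequalizer_def using * by simp
  then show ?thesis unfolding regular_epi_def by blast
qed

text \<open>Regular epimorphisms are orthogonal to monomorphisms. The lift \<open>h\<close> of
  \<open>e \<Zsemi> f\<close> through \<open>m\<close> equalizes the pair that \<open>e\<close>
  coequalizes, because it does so after composing with the monic \<open>m\<close>; hence
  \<open>h\<close> factors through \<open>e\<close>.\<close>

lemma factors_through_descent:
  assumes e: "regular_epi C e" "e \<in> hom C d' d" and f: "f \<in> hom C d a"
    and m: "monic C m" "Cod C m = a" and fac: "factors_through C (e \<Zsemi> f) m"
  shows "factors_through C f m"
proof -
  obtain a' b' where ab: "is_coequalizer C a' b' e" using e unfolding regular_epi_def by blast
  then have *: "a' \<in> Arr C" "b' \<in> Arr C" "Dom C a' = Dom C b'" "Cod C a' = d'" "Cod C b' = d'"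
      "a' \<Zsemi> e = b' \<Zsemi> e" "Cod C a' = Cod C b'"
    using e(2) unfolding is_coequalizer_def hom_def by auto
  have mh: "m \<in> hom C (Dom C m) a" using m monic_hom by metis
  obtain h where h: "h \<in> hom C d' (Dom C m)" "h \<Zsemi> m = e \<Zsemi> f"
    using fac mh e f factors_through_iff[of "e \<Zsemi> f" d' a m "Dom C m"]
    by (auto simp: hom_iff comp_simps)
  have "(a' \<Zsemi> h) \<Zsemi> m = (a' \<Zsemi> e) \<Zsemi> f" using h *(1-5) e f mh by (simp add: hom_iff assoc)
  also have "\<dots> = (b' \<Zsemi> h) \<Zsemi> m" unfolding *(6) using h *(1-5) e f mh
    by (simp add: hom_iff assoc)
  finally have "a' \<Zsemi> h = b' \<Zsemi> h"
    using monicD[OF m(1), of "a' \<Zsemi> h" "Dom C a'" "b' \<Zsemi> h"] h * Dom_Obj[of b']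
    by (simp add: hom_iff comp_simps)
  then obtain k where k: "k \<in> hom C d (Dom C m)" "e \<Zsemi> k = h"
    using coequalizer_factor[OF ab e(2) h(1)] by blast
  have "e \<Zsemi> (k \<Zsemi> m) = e \<Zsemi> f" using k h e mh by (simp add: hom_iff flip: assoc)
  then have "k \<Zsemi> m = f"
    using regular_epi_cancel[OF e(1), of "k \<Zsemi> m" a f] e f k mh
    by (simp add: hom_iff comp_simps)
  then show ?thesis using k f mh factors_through_iff by blast
qed

lemma belongs_descent:
  assumes "X \<in> subobjects C a" "regular_epi C e" "e \<in> hom C d' d" "f \<in> hom C d a"
    "belongs (e \<Zsemi> f) X"
  shows "belongs f X"
  using assms(5) factors_through_descent[OF assms(2-4) subobject_member(1)[OF assms(1)]]
    subobject_member(2)[OF assms(1)]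
  unfolding belongs_def hom_iff by blast

end

section \<open>Images\<close>

text \<open>The shape of a cospan: identities \<open>0, 1, 2\<close> and the arrows \<open>3 : 0 \<rightarrow> 2\<close>, \<open>4 : 1 \<rightarrow> 2\<close>.\<close>

definition cospan_shape :: "(nat, nat) category_data" where
  "cospan_shape = \<lparr>Obj = {0, 1, 2}, Arr = {0, 1, 2, 3, 4},
     Dom = (\<lambda>u. if u = 3 then 0 else if u = 4 then 1 else u),
     Cod = (\<lambda>u. if u = 3 \<or> u = 4 then 2 else u),
     ident = (\<lambda>i. i), comp = (\<lambda>u v. if u < 3 then v else u)\<rparr>"

lemma cospan_simps:
  "Obj cospan_shape = {0, 1, 2}" "Arr cospan_shape = {0, 1, 2, 3, 4}"
  "Dom cospan_shape 0 = 0" "Dom cospan_shape 1 = 1" "Dom cospan_shape 2 = 2"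
  "Dom cospan_shape 3 = 0" "Dom cospan_shape 4 = 1"
  "Cod cospan_shape 0 = 0" "Cod cospan_shape 1 = 1" "Cod cospan_shape 2 = 2"
  "Cod cospan_shape 3 = 2" "Cod cospan_shape 4 = 2"
  "ident cospan_shape i = i"
  "comp cospan_shape 0 v = v" "comp cospan_shape 1 v = v" "comp cospan_shape 2 v = v"
  "comp cospan_shape 3 v = 3" "comp cospan_shape 4 v = 4"
  by (simp_all add: cospan_shape_def)

text \<open>Composing with one of the identities 0, 1, 2 on the left returns the second factor. The
  arrows 3 and 4 end at 2, where only the identity starts, so there the first factor is the right
  value.\<close>

lemma cospan_category: "category cospan_shape"
  by unfold_locales (auto simp: cospan_shape_def hom_def)

section \<open>Pullbacks, lifting along covers, image factorization\<close>

context regular_category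
begin

lemma pullback_exists:
  assumes "f \<in> hom C a c" "g \<in> hom C b c"
  shows "\<exists>p q. is_pullback C f g p q"
proof -
  define Fo where "Fo i = (if i = (0::nat) then a else if i = 1 then b else c)" for i
  define Fa where "Fa u = (if u = (3::nat) then f else if u = 4 then g else \<one> (Fo u))" for u
  have F: "Fo 0 = a" "Fo 1 = b" "Fo 2 = c"
      "Fa 0 = \<one> a" "Fa 1 = \<one> b" "Fa 2 = \<one> c" "Fa 3 = f" "Fa 4 = g"
    by (simp_all add: Fo_def Fa_def)
  have "is_functor cospan_shape C Fo Fa"
    unfolding is_functor_def using assms
    by (simp add: cospan_simps F hom_iff ident_simps ident_comp del: One_nat_def)
  then obtain l \<pi> where l: "is_limit cospan_shape C Fo Fa l \<pi>"
    using finite_limits cospan_category unfolding has_finite_limits_def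
    by (metis cospan_simps(2) finite.emptyI finite.insertI)
  then have cone: "is_cone cospan_shape C Fo Fa l \<pi>" unfolding is_limit_def by blast
  have p: "\<pi> 0 \<in> hom C l a" "\<pi> 1 \<in> hom C l b" "\<pi> 0 \<Zsemi> f = \<pi> 2" "\<pi> 1 \<Zsemi> g = \<pi> 2"
    using cone unfolding is_cone_def by (simp_all add: cospan_simps F del: One_nat_def)
  have "\<exists>!h. h \<in> hom C d l \<and> h \<Zsemi> \<pi> 0 = u \<and> h \<Zsemi> \<pi> 1 = v"
    if uv: "u \<in> hom C d a" "v \<in> hom C d b" "u \<Zsemi> f = v \<Zsemi> g" for d u v
  proof -
    define \<chi> where "\<chi> i = (if i = (0::nat) then u else if i = 1 then v else u \<Zsemi> f)" for i
    have \<chi>: "\<chi> 0 = u" "\<chi> 1 = v" "\<chi> 2 = u \<Zsemi> f" by (simp_all add: \<chi>_def)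
    have "is_cone cospan_shape C Fo Fa d \<chi>"
      unfolding is_cone_def using uv assms
      by (simp add: cospan_simps F \<chi> hom_iff comp_simps ident_comp del: One_nat_def)
    then have *: "\<exists>!h. h \<in> hom C d l \<and> (\<forall>i \<in> Obj cospan_shape. h \<Zsemi> \<pi> i = \<chi> i)"
      using l unfolding is_limit_def by blast
    \<comment> \<open>The leg at the corner 2 is the leg at 0 followed by \<open>f\<close>, so the
      condition on a mediating arrow reduces to the two outer legs.\<close>
    have "(\<forall>i \<in> Obj cospan_shape. h \<Zsemi> \<pi> i = \<chi> i) \<longleftrightarrow> h \<Zsemi> \<pi> 0 = u \<and> h \<Zsemi> \<pi> 1 = v"
      if "h \<in> hom C d l" for h
    proof -
      have "h \<Zsemi> \<pi> 2 = (h \<Zsemi> \<pi> 0) \<Zsemi> f"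
        using that p(1) assms(1) by (simp add: hom_iff arr_simps flip: p(3))
      then show ?thesis by (auto simp add: cospan_simps \<chi> simp del: One_nat_def)
    qed
    with * show ?thesis by (metis (no_types, lifting))
  qed
  moreover have "f \<in> Arr C" "g \<in> Arr C" "\<pi> 0 \<in> Arr C" "\<pi> 1 \<in> Arr C"
      "Dom C f = a" "Cod C f = c" "Dom C g = b" "Cod C g = c"
      "Dom C (\<pi> 0) = l" "Cod C (\<pi> 0) = a" "Dom C (\<pi> 1) = l" "Cod C (\<pi> 1) = b"
    using p(1,2) assms by (simp_all add: hom_iff)
  ultimately have "is_pullback C f g (\<pi> 0) (\<pi> 1)"
    unfolding is_pullback_def using p(3,4) by simp
  then show ?thesis by blast
qed

lemma pullbackE:
  assumes "is_pullback C f g p q" "f \<in> hom C a c" "g \<in> hom C b c"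
  obtains l where "p \<in> hom C l a" "q \<in> hom C l b" "p \<Zsemi> f = q \<Zsemi> g"
    "\<forall>d. \<forall>u \<in> hom C d a. \<forall>v \<in> hom C d b. u \<Zsemi> f = v \<Zsemi> g \<longrightarrow>
       (\<exists>h \<in> hom C d l. h \<Zsemi> p = u \<and> h \<Zsemi> q = v)"
proof (rule that[of "Dom C p"])
  show "p \<in> hom C (Dom C p) a" "q \<in> hom C (Dom C p) b" "p \<Zsemi> f = q \<Zsemi> g"
    using assms unfolding is_pullback_def hom_def by auto
  have "Dom C f = a" "Dom C g = b" using assms unfolding hom_def by auto
  then show "\<forall>d. \<forall>u \<in> hom C d a. \<forall>v \<in> hom C d b. u \<Zsemi> f = v \<Zsemi> g \<longrightarrow>
       (\<exists>h \<in> hom C d (Dom C p). h \<Zsemi> p = u \<and> h \<Zsemi> q = v)"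
    using assms(1) unfolding is_pullback_def by blast
qed

text \<open>A regular epimorphism need not split, but over its pullback along \<open>u\<close> the
  arrow \<open>u\<close> lifts, and by stability that pullback covers \<open>d\<close>. All
  nontrivial covers in the proof originate here.\<close>

lemma lift_along_regular_epi:
  assumes "regular_epi C e" "e \<in> hom C b a" "u \<in> hom C d a"
  obtains d' e' u' where "regular_epi C e'" "e' \<in> hom C d' d" "u' \<in> hom C d' b"
    "u' \<Zsemi> e = e' \<Zsemi> u"
proof -
  obtain p q where pq: "is_pullback C e u p q" using pullback_exists[OF assms(2,3)] by blast
  have "regular_epi C q" using regular_epi_stable[OF pq assms(1)] .
  moreover obtain l where "p \<in> hom C l b" "q \<in> hom C l d" "p \<Zsemi> e = q \<Zsemi> u"
    using pullbackE[OF pq assms(2,3)] .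
  ultimately show ?thesis using that by blast
qed

text \<open>With \<open>e\<close> the coequalizer of the kernel pair of \<open>f\<close>, the
  induced \<open>m\<close> is monic: two elements identified by \<open>m\<close> lift, on a cover,
  to elements with equal image under \<open>f\<close>. These form an element of the kernel pair,
  whose legs are identified by \<open>e\<close>.\<close>

lemma image_factorization:
  assumes f: "f \<in> hom C a b"
  obtains e m c where "regular_epi C e" "e \<in> hom C a c" "monic C m" "m \<in> hom C c b" "e \<Zsemi> m = f"
proof -
  obtain p q where pq: "is_pullback C f f p q" using pullback_exists[OF f f] by blast
  then obtain e where e: "is_coequalizer C p q e" using kernel_pair_coequalizer by blast
  obtain l where l: "p \<in> hom C l a" "q \<in> hom C l a" "p \<Zsemi> f = q \<Zsemi> f"
    "\<forall>d. \<forall>u \<in> hom C d a. \<forall>v \<in> hom C d a. u \<Zsemi> f = v \<Zsemi> f \<longrightarrow>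
       (\<exists>h \<in> hom C d l. h \<Zsemi> p = u \<and> h \<Zsemi> q = v)"
    using pullbackE[OF pq f f] .
  have re: "regular_epi C e" using e unfolding regular_epi_def by blast
  define c where "c = Cod C e"
  have eh: "e \<in> hom C a c" and pe: "p \<Zsemi> e = q \<Zsemi> e"
    using e l(1) Cod_Obj[of e] unfolding is_coequalizer_def hom_iff c_def by auto
  obtain m where m: "m \<in> hom C c b" "e \<Zsemi> m = f"
    using coequalizer_factor[OF e eh f l(3)] .
  have "u = v" if uv: "u \<in> hom C d c" "v \<in> hom C d c" "u \<Zsemi> m = v \<Zsemi> m" for d u v
  proof -
    obtain d1 e1 u1 where 1: "regular_epi C e1" "e1 \<in> hom C d1 d" "u1 \<in> hom C d1 a"
        "u1 \<Zsemi> e = e1 \<Zsemi> u"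
      using lift_along_regular_epi[OF re eh uv(1)] .
    have e1v: "e1 \<Zsemi> v \<in> hom C d1 c" using 1 uv by (simp add: hom_iff arr_simps)
    \<comment> \<open>The second lift is taken over the cover \<open>d1\<close> produced by the
      first, so that both lifts can be compared over \<open>d2\<close>.\<close>
    obtain d2 e2 v2 where 2: "regular_epi C e2" "e2 \<in> hom C d2 d1" "v2 \<in> hom C d2 a"
        "v2 \<Zsemi> e = e2 \<Zsemi> (e1 \<Zsemi> v)"
      using lift_along_regular_epi[OF re eh e1v] .
    have e21u: "(e2 \<Zsemi> u1) \<Zsemi> e = e2 \<Zsemi> (e1 \<Zsemi> u)"
      using 1 2 eh by (simp add: hom_iff assoc)
    have "(e2 \<Zsemi> u1) \<Zsemi> f = ((e2 \<Zsemi> u1) \<Zsemi> e) \<Zsemi> m"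
      unfolding m(2)[symmetric] using 1(1-3) 2(1-3) eh m(1) by (simp add: hom_iff arr_simps)
    also have "\<dots> = e2 \<Zsemi> (e1 \<Zsemi> (v \<Zsemi> m))"
      unfolding e21u uv(3)[symmetric] using 1(1-3) 2(1-3) uv(1,2) m(1) by (simp add: hom_iff arr_simps)
    also have "\<dots> = (v2 \<Zsemi> e) \<Zsemi> m"
      unfolding 2(4) using 1(1-3) 2(1-3) uv(1,2) m(1) by (simp add: hom_iff arr_simps)
    also have "\<dots> = v2 \<Zsemi> f"
      unfolding m(2)[symmetric] using 1(1-3) 2(1-3) eh m(1) by (simp add: hom_iff arr_simps)
    finally have "(e2 \<Zsemi> u1) \<Zsemi> f = v2 \<Zsemi> f" .
    moreover have "e2 \<Zsemi> u1 \<in> hom C d2 a" using 1 2 by (simp add: hom_iff comp_simps)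
    ultimately obtain h where h: "h \<in> hom C d2 l" "h \<Zsemi> p = e2 \<Zsemi> u1" "h \<Zsemi> q = v2"
      using l(4) 2(3) by blast
    have "e2 \<Zsemi> (e1 \<Zsemi> u) = (h \<Zsemi> p) \<Zsemi> e" unfolding h e21u ..
    also have "\<dots> = (h \<Zsemi> q) \<Zsemi> e" using h(1) l(1,2) pe eh by (simp add: hom_iff assoc)
    also have "\<dots> = e2 \<Zsemi> (e1 \<Zsemi> v)" unfolding h 2 ..
    finally have "e1 \<Zsemi> u = e1 \<Zsemi> v"
      using regular_epi_cancel[OF 2(1)] 1 2 uv by (simp add: hom_iff arr_simps)
    then show "u = v" using regular_epi_cancel[OF 1(1)] 1 uv by (simp add: hom_iff)
  qed
  then have "monic C m" unfolding monic_def using m by (auto simp: hom_iff)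
  then show ?thesis using that re eh m by blast
qed

text \<open>The second claim is the existential meaning of an image: its elements are those that
  come from \<open>f\<close> after passing to a cover. This is the origin of the covers in
  \<open>comp_rel\<close>.\<close>

lemma image_subobject_subobjects:
  assumes "f \<in> hom C a b"
  shows "image_subobject C f \<in> subobjects C b"
    and "g \<in> hom C d b \<Longrightarrow> belongs g (image_subobject C f) \<longleftrightarrow>
      (\<exists>d'. \<exists>e \<in> hom C d' d. regular_epi C e \<and> factors_through C (e \<Zsemi> g) f)"
proof -
  obtain e m c where em: "regular_epi C e" "e \<in> hom C a c" "monic C m" "m \<in> hom C c b"
      "e \<Zsemi> m = f"
    using image_factorization[OF assms] .
  \<comment> \<open>Any two factorizations have monomorphisms that factor through each other, by
    descent along their regular epimorphisms. Conversely, an equivalent monomorphism differs from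
    \<open>m\<close> by an isomorphism, which \<open>e\<close> absorbs.\<close>
  have eq: "image_subobject C f = subobject_of C m"
  proof (intro set_eqI iffI)
    fix n assume "n \<in> image_subobject C f"
    then obtain e' where n: "monic C n" "regular_epi C e'" "Cod C e' = Dom C n" "e' \<Zsemi> n = f"
      unfolding image_subobject_def by blast
    have nh: "n \<in> hom C (Dom C n) (Cod C n)" and e'h: "e' \<in> hom C (Dom C e') (Dom C n)"
      using n monic_hom regular_epi_hom by metis+
    have e'n: "Dom C e' = a" "Cod C n = b" using nh e'h n(4) assms
      by (auto simp: hom_iff comp_simps)
    have "factors_through C f m" "factors_through C f n"
      using em n nh e'h e'n assms unfolding factors_through_def by (auto simp: hom_iff)
    then have "factors_through C m n" "factors_through C n m"
      using factors_through_descent[of e a c m b n] factors_through_descent[of e' a "Dom C n" n b m]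
        em n nh e'h e'n by (auto simp: hom_iff)
    then show "n \<in> subobject_of C m"
      unfolding subobject_of_def using n e'n em by (auto simp: hom_iff)
  next
    fix n assume "n \<in> subobject_of C m"
    then have n: "monic C n" "Cod C n = b" "factors_through C m n" "factors_through C n m"
      using em unfolding subobject_of_def by (auto simp: hom_iff)
    have nh: "n \<in> hom C (Dom C n) b" using n monic_hom by metis
    obtain i j where ij: "i \<in> hom C c (Dom C n)" "i \<Zsemi> n = m" "j \<in> hom C (Dom C n) c" "j \<Zsemi> m = n"
      using n(3,4) factors_through_iff[OF em(4) nh] factors_through_iff[OF nh em(4)] by blast
    have "(i \<Zsemi> j) \<Zsemi> m = i \<Zsemi> (j \<Zsemi> m)" "(j \<Zsemi> i) \<Zsemi> n = j \<Zsemi> (i \<Zsemi> n)"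
      using ij(1,3) em(4) nh by (simp_all add: hom_iff assoc)
    then have "(i \<Zsemi> j) \<Zsemi> m = \<one> c \<Zsemi> m" "(j \<Zsemi> i) \<Zsemi> n = \<one> (Dom C n) \<Zsemi> n"
      using ij(2,4) em(4) nh by (simp_all add: hom_iff ident_comp)
    moreover have "i \<Zsemi> j \<in> hom C c (Dom C m)" "\<one> c \<in> hom C c (Dom C m)"
        "j \<Zsemi> i \<in> hom C (Dom C n) (Dom C n)" "\<one> (Dom C n) \<in> hom C (Dom C n) (Dom C n)"
      using ij(1,3) em(4) nh by (simp_all add: hom_iff comp_simps ident_simps)
    ultimately have "i \<Zsemi> j = \<one> c" "j \<Zsemi> i = \<one> (Dom C n)"
      using monicD[OF em(3)] monicD[OF n(1)] by blast+
    then have "regular_epi C (e \<Zsemi> i)"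
      using regular_epi_comp_iso[OF em(1,2) ij(1,3)] by blast
    moreover have "Cod C (e \<Zsemi> i) = Dom C n" "(e \<Zsemi> i) \<Zsemi> n = f"
      using em ij nh by (simp_all add: hom_iff arr_simps)
    ultimately show "n \<in> image_subobject C f" unfolding image_subobject_def using n by blast
  qed
  show "image_subobject C f \<in> subobjects C b"
    unfolding eq using subobject_of_subobjects[OF em(3)] em(4) by (simp add: hom_iff)
  assume g: "g \<in> hom C d b"
  have "belongs g (image_subobject C f) \<longleftrightarrow> factors_through C g m"
    unfolding eq using belongs_subobject_of em g by (simp add: hom_iff)
  \<comment> \<open>One direction lifts the factor of \<open>g\<close> along the regular epimorphism
    \<open>e\<close> of the factorization; the other descends along the given cover.\<close>
  also have "\<dots> \<longleftrightarrow> (\<exists>d'. \<exists>e \<in> hom C d' d. regular_epi C e \<and> factors_through C (e \<Zsemi> g) f)"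
  proof
    assume "factors_through C g m"
    then obtain h where h: "h \<in> hom C d c" "h \<Zsemi> m = g" using g em(4) factors_through_iff by metis
    obtain d' e' u where u: "regular_epi C e'" "e' \<in> hom C d' d" "u \<in> hom C d' a"
        "u \<Zsemi> e = e' \<Zsemi> h"
      using lift_along_regular_epi[OF em(1,2) h(1)] .
    have "u \<Zsemi> f = (u \<Zsemi> e) \<Zsemi> m" unfolding em(5)[symmetric] using u(1-3) em(2,4) by (simp add: hom_iff assoc)
    also have "\<dots> = e' \<Zsemi> g" unfolding u(4) h(2)[symmetric] using u(1-3) h(1) em(4) by (simp add: hom_iff assoc)
    finally have "factors_through C (e' \<Zsemi> g) f"
      using u g assms unfolding factors_through_def by (auto simp: hom_iff comp_simps)
    then show "\<exists>d'. \<exists>e \<in> hom C d' d. regular_epi C e \<and> factors_through C (e \<Zsemi> g) f"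
      using u by blast
  next
    assume "\<exists>d'. \<exists>e \<in> hom C d' d. regular_epi C e \<and> factors_through C (e \<Zsemi> g) f"
    then obtain d' e' where e': "e' \<in> hom C d' d" "regular_epi C e'" "factors_through C (e' \<Zsemi> g) f"
      by blast
    have "factors_through C f m"
      using em assms unfolding factors_through_def by (auto simp: hom_iff)
    then have "factors_through C (e' \<Zsemi> g) m"
      using factors_through_trans[of "e' \<Zsemi> g" d' b f a m c] e' g assms em
      by (auto simp: hom_iff comp_simps)
    then show "factors_through C g m"
      using factors_through_descent[OF e'(2,1) g em(3)] em(4) by (simp add: hom_iff)
  qed
  finally show "belongs g (image_subobject C f) \<longleftrightarrow>
      (\<exists>d'. \<exists>e \<in> hom C d' d. regular_epi C e \<and> factors_through C (e \<Zsemi> g) f)" .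
qed

end

section \<open>Relations through generalized elements\<close>

locale regular_category_with_products = regular_category C
  for C :: "('o, 'm, 'x) category_data_scheme" (structure) +
  fixes P :: "('o, 'm) products_data"
  assumes products: "chosen_products C P"
begin

abbreviation pair :: "'m \<Rightarrow> 'm \<Rightarrow> 'm" ("\<langle>_, _\<rangle>") where "\<langle>f, g\<rangle> \<equiv> pairing C P f g"

section \<open>Chosen products and pairings\<close>

lemma is_product_prod:
  "a \<in> Obj C \<Longrightarrow> b \<in> Obj C \<Longrightarrow> is_product C a b (prod P a b) (proj1 P a b) (proj2 P a b)"
  using products unfolding chosen_products_def by blast

lemma proj_hom:
  assumes "a \<in> Obj C" "b \<in> Obj C"
  shows "proj1 P a b \<in> hom C (prod P a b) a" "proj2 P a b \<in> hom C (prod P a b) b"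
  using is_product_prod[OF assms] unfolding is_product_def by auto

lemma pairing_hom:
  assumes "f \<in> hom C d a" "g \<in> hom C d b"
  shows "\<langle>f, g\<rangle> \<in> hom C d (prod P a b)" "\<langle>f, g\<rangle> \<Zsemi> proj1 P a b = f" "\<langle>f, g\<rangle> \<Zsemi> proj2 P a b = g"
proof -
  have "a \<in> Obj C" "b \<in> Obj C" using assms by (auto simp: hom_iff)
  then have "\<exists>!h. h \<in> hom C d (prod P a b) \<and> h \<Zsemi> proj1 P a b = f \<and> h \<Zsemi> proj2 P a b = g"
    using is_product_prod assms unfolding is_product_def by blast
  then have "\<langle>f, g\<rangle> \<in> hom C d (prod P a b) \<and> \<langle>f, g\<rangle> \<Zsemi> proj1 P a b = f \<and> \<langle>f, g\<rangle> \<Zsemi> proj2 P a b = g"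
    using assms theI'[of "\<lambda>h. h \<in> hom C d (prod P a b) \<and> h \<Zsemi> proj1 P a b = f \<and> h \<Zsemi> proj2 P a b = g"]
    unfolding pairing_def by (simp add: hom_def)
  then show "\<langle>f, g\<rangle> \<in> hom C d (prod P a b)" "\<langle>f, g\<rangle> \<Zsemi> proj1 P a b = f" "\<langle>f, g\<rangle> \<Zsemi> proj2 P a b = g"
    by auto
qed

lemma prod_arr_eqI:
  assumes "h \<in> hom C d (prod P a b)" "k \<in> hom C d (prod P a b)" "a \<in> Obj C" "b \<in> Obj C"
    and "h \<Zsemi> proj1 P a b = k \<Zsemi> proj1 P a b" "h \<Zsemi> proj2 P a b = k \<Zsemi> proj2 P a b"
  shows "h = k"
proof -
  have "k \<Zsemi> proj1 P a b \<in> hom C d a" "k \<Zsemi> proj2 P a b \<in> hom C d b"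
    using assms proj_hom comp_hom by blast+
  then have "\<exists>!h. h \<in> hom C d (prod P a b) \<and> h \<Zsemi> proj1 P a b = k \<Zsemi> proj1 P a b \<and>
      h \<Zsemi> proj2 P a b = k \<Zsemi> proj2 P a b"
    using is_product_prod[OF assms(3,4)] unfolding is_product_def by blast
  then show ?thesis using assms(1,2,5,6) by blast
qed

lemma pairing_proj:
  assumes "h \<in> hom C d (prod P a b)" "a \<in> Obj C" "b \<in> Obj C"
  shows "\<langle>h \<Zsemi> proj1 P a b, h \<Zsemi> proj2 P a b\<rangle> = h"
proof -
  have *: "h \<Zsemi> proj1 P a b \<in> hom C d a" "h \<Zsemi> proj2 P a b \<in> hom C d b"
    using assms proj_hom comp_hom by blast+
  show ?thesis by (rule prod_arr_eqI[OF pairing_hom(1)[OF *] assms]) (simp_all add: pairing_hom[OF *])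
qed

lemma comp_pairing:
  assumes "k \<in> hom C d' d" "f \<in> hom C d a" "g \<in> hom C d b"
  shows "k \<Zsemi> \<langle>f, g\<rangle> = \<langle>k \<Zsemi> f, k \<Zsemi> g\<rangle>"
proof -
  have ab: "a \<in> Obj C" "b \<in> Obj C" using assms by (auto simp: hom_iff)
  note fg = pairing_hom[OF assms(2,3)]
  have *: "k \<Zsemi> f \<in> hom C d' a" "k \<Zsemi> g \<in> hom C d' b" using assms comp_hom by blast+
  show ?thesis
    by (rule prod_arr_eqI[OF comp_hom[OF assms(1) fg(1)] pairing_hom(1)[OF *] ab])
      (simp_all add: pairing_hom[OF *] comp_assoc[OF assms(1) fg(1) proj_hom(1)[OF ab]]
        comp_assoc[OF assms(1) fg(1) proj_hom(2)[OF ab]] fg)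
qed

lemma pairing_eq_iff:
  assumes "f \<in> hom C d a" "g \<in> hom C d b" "f' \<in> hom C d a" "g' \<in> hom C d b"
  shows "\<langle>f, g\<rangle> = \<langle>f', g'\<rangle> \<longleftrightarrow> f = f' \<and> g = g'"
  using pairing_hom[OF assms(1,2)] pairing_hom[OF assms(3,4)] by metis

lemma eq_pairing_iff:
  assumes "h \<in> hom C d (prod P a b)" "f \<in> hom C d a" "g \<in> hom C d b"
  shows "h = \<langle>f, g\<rangle> \<longleftrightarrow> h \<Zsemi> proj1 P a b = f \<and> h \<Zsemi> proj2 P a b = g"
proof -
  have "a \<in> Obj C" "b \<in> Obj C" using assms by (auto simp: hom_iff)
  then show ?thesis using pairing_hom[OF assms(2,3)] pairing_proj[OF assms(1)] by metis
qed

lemma monic_pairing: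
  assumes "f \<in> hom C n a" "g \<in> hom C n b"
    and "\<And>d u v. \<lbrakk>u \<in> hom C d n; v \<in> hom C d n; u \<Zsemi> f = v \<Zsemi> f; u \<Zsemi> g = v \<Zsemi> g\<rbrakk> \<Longrightarrow> u = v"
  shows "monic C \<langle>f, g\<rangle>"
proof -
  note fg = pairing_hom(1)[OF assms(1,2)]
  have "u = v" if uv: "u \<in> hom C d n" "v \<in> hom C d n" "u \<Zsemi> \<langle>f, g\<rangle> = v \<Zsemi> \<langle>f, g\<rangle>" for d u v
  proof -
    have "\<langle>u \<Zsemi> f, u \<Zsemi> g\<rangle> = \<langle>v \<Zsemi> f, v \<Zsemi> g\<rangle>"
      using uv comp_pairing assms(1,2) by metis
    then have "u \<Zsemi> f = v \<Zsemi> f \<and> u \<Zsemi> g = v \<Zsemi> g"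
      using pairing_eq_iff comp_hom[OF uv(1) assms(1)] comp_hom[OF uv(1) assms(2)]
        comp_hom[OF uv(2) assms(1)] comp_hom[OF uv(2) assms(2)] by blast
    then show ?thesis using assms(3) uv by blast
  qed
  then show ?thesis unfolding monic_def using fg by (simp add: hom_def)
qed

lemma factors_through_pairing:
  assumes "u \<in> hom C d a" "v \<in> hom C d b" "f \<in> hom C n a" "g \<in> hom C n b"
  shows "factors_through C \<langle>u, v\<rangle> \<langle>f, g\<rangle> \<longleftrightarrow> (\<exists>w \<in> hom C d n. w \<Zsemi> f = u \<and> w \<Zsemi> g = v)"
proof -
  have "w \<Zsemi> \<langle>f, g\<rangle> = \<langle>u, v\<rangle> \<longleftrightarrow> w \<Zsemi> f = u \<and> w \<Zsemi> g = v" if w: "w \<in> hom C d n" for w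
    using comp_pairing[OF w assms(3,4)] comp_hom[OF w assms(3)] comp_hom[OF w assms(4)]
      pairing_eq_iff[OF _ _ assms(1,2)] by simp
  then show ?thesis
    using factors_through_iff[OF pairing_hom(1)[OF assms(1,2)] pairing_hom(1)[OF assms(3,4)]] by simp
qed

section \<open>Order and equality of relations through their elements\<close>

definition holds :: "('o, 'm) rel \<Rightarrow> 'm \<Rightarrow> 'm \<Rightarrow> bool" where
  "holds R f g \<longleftrightarrow> belongs \<langle>f, g\<rangle> (snd (snd R))"

lemma Rel_simps:
  "Obj (Rel C P) = Obj C"
  "ident (Rel C P) a = rel_graph C P (\<one> a)"
  "comp (Rel C P) = rel_comp C P"
  "le (Rel C P) = rel_le C"
  "tensor (Rel C P) = rel_tensor C P"
  "tensor_obj (Rel C P) = prod P"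
  "unit_obj (Rel C P) = terminal P"
  by (simp_all add: Rel_def)

lemma rel_hom_iff:
  "(a', b', X) \<in> hom (Rel C P) a b \<longleftrightarrow>
     a' = a \<and> b' = b \<and> a \<in> Obj C \<and> b \<in> Obj C \<and> X \<in> subobjects C (prod P a b)"
  by (auto simp: Rel_def hom_def)

lemma rel_homE:
  assumes "R \<in> hom (Rel C P) a b"
  obtains X where "R = (a, b, X)" "a \<in> Obj C" "b \<in> Obj C" "X \<in> subobjects C (prod P a b)"
  using assms by (cases R) (auto simp: rel_hom_iff)

lemma rel_le_iff:
  assumes "R \<in> hom (Rel C P) a b" "S \<in> hom (Rel C P) a b"
  shows "le (Rel C P) R S \<longleftrightarrow>
    (\<forall>d. \<forall>f \<in> hom C d a. \<forall>g \<in> hom C d b. holds R f g \<longrightarrow> holds S f g)"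
proof -
  obtain X Y where XY: "R = (a, b, X)" "S = (a, b, Y)" and ab: "a \<in> Obj C" "b \<in> Obj C"
    and sub: "X \<in> subobjects C (prod P a b)" "Y \<in> subobjects C (prod P a b)"
    using assms rel_homE by metis
  have "le (Rel C P) R S \<longleftrightarrow> (\<forall>d. \<forall>h \<in> hom C d (prod P a b). belongs h X \<longrightarrow> belongs h Y)"
    using subobject_le_iff[OF sub] by (simp add: Rel_simps XY)
  also have "\<dots> \<longleftrightarrow> (\<forall>d. \<forall>f \<in> hom C d a. \<forall>g \<in> hom C d b. holds R f g \<longrightarrow> holds S f g)"
  proof (intro iffI allI ballI impI)
    fix d f g
    assume "\<forall>d. \<forall>h \<in> hom C d (prod P a b). belongs h X \<longrightarrow> belongs h Y"
      and "f \<in> hom C d a" "g \<in> hom C d b" "holds R f g"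
    then show "holds S f g" using pairing_hom(1)[of f d a g b] unfolding holds_def XY by simp
  next
    fix d h
    assume *: "\<forall>d. \<forall>f \<in> hom C d a. \<forall>g \<in> hom C d b. holds R f g \<longrightarrow> holds S f g"
      and h: "h \<in> hom C d (prod P a b)" "belongs h X"
    have "h \<Zsemi> proj1 P a b \<in> hom C d a" "h \<Zsemi> proj2 P a b \<in> hom C d b"
      using h ab proj_hom comp_hom by blast+
    with * have "belongs \<langle>h \<Zsemi> proj1 P a b, h \<Zsemi> proj2 P a b\<rangle> X \<longrightarrow>
        belongs \<langle>h \<Zsemi> proj1 P a b, h \<Zsemi> proj2 P a b\<rangle> Y"
      unfolding holds_def XY by simp
    then show "belongs h Y" using h(2) unfolding pairing_proj[OF h(1) ab] by blast
  qed
  finally show ?thesis .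
qed

text \<open>Extensionality serves two ends: it proves the monoid laws and uniqueness, and it shows
  that tensors and composites do not depend on the choices in their definitions.\<close>

lemma rel_eqI:
  assumes "R \<in> hom (Rel C P) a b" "S \<in> hom (Rel C P) a b"
    and *: "\<And>d f g. f \<in> hom C d a \<Longrightarrow> g \<in> hom C d b \<Longrightarrow> holds R f g \<longleftrightarrow> holds S f g"
  shows "R = S"
proof -
  obtain X Y where XY: "R = (a, b, X)" "S = (a, b, Y)" and ab: "a \<in> Obj C" "b \<in> Obj C"
    and sub: "X \<in> subobjects C (prod P a b)" "Y \<in> subobjects C (prod P a b)"
    using assms(1,2) rel_homE by metis
  have "X = Y"
  proof (rule subobject_eqI[OF sub])
    fix d h assume h: "h \<in> hom C d (prod P a b)"
    have "h \<Zsemi> proj1 P a b \<in> hom C d a" "h \<Zsemi> proj2 P a b \<in> hom C d b"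
      using h ab proj_hom comp_hom by blast+
    from *[OF this] show "belongs h X \<longleftrightarrow> belongs h Y"
      unfolding holds_def XY pairing_proj[OF h ab] by simp
  qed
  then show ?thesis using XY by simp
qed

text \<open>Brings back to \<open>d\<close> what was concluded on a cover of \<open>d\<close>; the
  counterpart of the cover that \<open>comp_relE\<close> introduces.\<close>

lemma holds_descent:
  assumes "R \<in> hom (Rel C P) a b" "f \<in> hom C d a" "g \<in> hom C d b"
    and "regular_epi C e" "e \<in> hom C d' d" "holds R (e \<Zsemi> f) (e \<Zsemi> g)"
  shows "holds R f g"
  using assms(1) belongs_descent[OF _ assms(4,5) pairing_hom(1)[OF assms(2,3)]] assms(6)
    comp_pairing[OF assms(5,2,3)]
  by (auto elim!: rel_homE simp: holds_def)

text \<open>A jointly monic span is a relation without taking an image, so its elements need no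
  cover. Graphs, their converses and tensors all arise in this way.\<close>

lemma span_rel:
  assumes "f \<in> hom C n a" "g \<in> hom C n b" "monic C \<langle>f, g\<rangle>"
  shows "(a, b, subobject_of C \<langle>f, g\<rangle>) \<in> hom (Rel C P) a b"
    and "\<lbrakk>u \<in> hom C d a; v \<in> hom C d b\<rbrakk> \<Longrightarrow> holds (a, b, subobject_of C \<langle>f, g\<rangle>) u v \<longleftrightarrow>
      (\<exists>w \<in> hom C d n. w \<Zsemi> f = u \<and> w \<Zsemi> g = v)"
proof -
  have *: "Cod C \<langle>f, g\<rangle> = prod P a b" using pairing_hom(1)[OF assms(1,2)] by (simp add: hom_iff)
  show "(a, b, subobject_of C \<langle>f, g\<rangle>) \<in> hom (Rel C P) a b"
    using subobject_of_subobjects[OF assms(3)] assms(1,2) by (simp add: rel_hom_iff hom_iff *)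
  assume uv: "u \<in> hom C d a" "v \<in> hom C d b"
  then show "holds (a, b, subobject_of C \<langle>f, g\<rangle>) u v \<longleftrightarrow> (\<exists>w \<in> hom C d n. w \<Zsemi> f = u \<and> w \<Zsemi> g = v)"
    using belongs_subobject_of[OF assms(3), of "\<langle>u, v\<rangle>" d] pairing_hom(1)[OF uv]
      factors_through_pairing[OF uv assms(1,2)]
    by (simp add: holds_def *)
qed

section \<open>Graphs and converse graphs\<close>

lemma graph_rel:
  assumes "f \<in> hom C a b"
  shows "rel_graph C P f \<in> hom (Rel C P) a b"
    and "\<lbrakk>u \<in> hom C d a; v \<in> hom C d b\<rbrakk> \<Longrightarrow> holds (rel_graph C P f) u v \<longleftrightarrow> u \<Zsemi> f = v"
proof -
  have 1: "\<one> a \<in> hom C a a" using assms ident_hom by (simp add: hom_iff)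
  have m: "monic C \<langle>\<one> a, f\<rangle>"
    by (rule monic_pairing[OF 1 assms]) (simp add: ident_right)
  have eq: "rel_graph C P f = (a, b, subobject_of C \<langle>\<one> a, f\<rangle>)"
    using assms by (simp add: rel_graph_def hom_iff)
  show "rel_graph C P f \<in> hom (Rel C P) a b" unfolding eq by (rule span_rel[OF 1 assms m])
  assume "u \<in> hom C d a" "v \<in> hom C d b"
  then show "holds (rel_graph C P f) u v \<longleftrightarrow> u \<Zsemi> f = v"
    unfolding eq span_rel(2)[OF 1 assms m \<open>u \<in> hom C d a\<close> \<open>v \<in> hom C d b\<close>]
    using ident_right by metis
qed

lemma ident_rel:
  assumes "a \<in> Obj C"
  shows "ident (Rel C P) a \<in> hom (Rel C P) a a"
    and "\<lbrakk>u \<in> hom C d a; v \<in> hom C d a\<rbrakk> \<Longrightarrow> holds (ident (Rel C P) a) u v \<longleftrightarrow> u = v"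
  using graph_rel[OF ident_hom[OF assms]] ident_right[of u d a] by (simp_all add: Rel_simps)

text \<open>The converse of \<open>rel_graph C P f\<close>: the same span with its legs
  exchanged.\<close>

definition cograph :: "'m \<Rightarrow> ('o, 'm) rel" where
  "cograph f = (Cod C f, Dom C f, subobject_of C \<langle>f, \<one> (Dom C f)\<rangle>)"

lemma cograph_rel:
  assumes "f \<in> hom C a b"
  shows "cograph f \<in> hom (Rel C P) b a"
    and "\<lbrakk>u \<in> hom C d b; v \<in> hom C d a\<rbrakk> \<Longrightarrow> holds (cograph f) u v \<longleftrightarrow> v \<Zsemi> f = u"
proof -
  have 1: "\<one> a \<in> hom C a a" using assms ident_hom by (simp add: hom_iff)
  have m: "monic C \<langle>f, \<one> a\<rangle>"
    by (rule monic_pairing[OF assms 1]) (simp add: ident_right)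
  have eq: "cograph f = (b, a, subobject_of C \<langle>f, \<one> a\<rangle>)"
    using assms by (simp add: cograph_def hom_iff)
  show "cograph f \<in> hom (Rel C P) b a" unfolding eq by (rule span_rel[OF assms 1 m])
  assume "u \<in> hom C d b" "v \<in> hom C d a"
  then show "holds (cograph f) u v \<longleftrightarrow> v \<Zsemi> f = u"
    unfolding eq span_rel(2)[OF assms 1 m \<open>u \<in> hom C d b\<close> \<open>v \<in> hom C d a\<close>]
    using ident_right by metis
qed

section \<open>Elements of tensors and composites\<close>

lemma rel_representative:
  assumes "(a, b, X) \<in> hom (Rel C P) a b" "x \<in> X"
  shows "x \<Zsemi> proj1 P a b \<in> hom C (Dom C x) a" "x \<Zsemi> proj2 P a b \<in> hom C (Dom C x) b"
    and "\<lbrakk>u \<in> hom C d a; v \<in> hom C d b\<rbrakk> \<Longrightarrow> holds (a, b, X) u v \<longleftrightarrow>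
      (\<exists>w \<in> hom C d (Dom C x). w \<Zsemi> (x \<Zsemi> proj1 P a b) = u \<and> w \<Zsemi> (x \<Zsemi> proj2 P a b) = v)"
    and "\<lbrakk>u \<in> hom C d (Dom C x); v \<in> hom C d (Dom C x);
      u \<Zsemi> (x \<Zsemi> proj1 P a b) = v \<Zsemi> (x \<Zsemi> proj1 P a b);
      u \<Zsemi> (x \<Zsemi> proj2 P a b) = v \<Zsemi> (x \<Zsemi> proj2 P a b)\<rbrakk> \<Longrightarrow> u = v"
proof -
  have X: "a \<in> Obj C" "b \<in> Obj C" "X \<in> subobjects C (prod P a b)"
    using assms(1) by (auto simp: rel_hom_iff)
  note x = subobject_member[OF X(3) assms(2)]
  show s: "x \<Zsemi> proj1 P a b \<in> hom C (Dom C x) a" "x \<Zsemi> proj2 P a b \<in> hom C (Dom C x) b"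
    using x(2) X(1,2) proj_hom comp_hom by blast+
  have eq: "\<langle>x \<Zsemi> proj1 P a b, x \<Zsemi> proj2 P a b\<rangle> = x" by (rule pairing_proj[OF x(2) X(1,2)])
  show "holds (a, b, X) u v \<longleftrightarrow>
      (\<exists>w \<in> hom C d (Dom C x). w \<Zsemi> (x \<Zsemi> proj1 P a b) = u \<and> w \<Zsemi> (x \<Zsemi> proj2 P a b) = v)"
    if "u \<in> hom C d a" "v \<in> hom C d b"
    using x(3)[OF pairing_hom(1)[OF that]] factors_through_pairing[OF that s]
    unfolding eq holds_def by simp
  assume uv: "u \<in> hom C d (Dom C x)" "v \<in> hom C d (Dom C x)"
      "u \<Zsemi> (x \<Zsemi> proj1 P a b) = v \<Zsemi> (x \<Zsemi> proj1 P a b)"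
      "u \<Zsemi> (x \<Zsemi> proj2 P a b) = v \<Zsemi> (x \<Zsemi> proj2 P a b)"
  have "u \<Zsemi> x = v \<Zsemi> x"
    using comp_pairing[OF uv(1) s] comp_pairing[OF uv(2) s] uv(3,4) unfolding eq by simp
  then show "u = v" using monicD[OF x(1) uv(1,2)] by blast
qed

text \<open>For the unions in \<open>rel_tensor\<close> and \<open>rel_comp\<close>: once some
  choice exists and all choices give the same subobject, the union is that subobject.\<close>

lemma Union_eq_if_all_eq: "x \<in> T \<Longrightarrow> (\<And>y. y \<in> T \<Longrightarrow> y = x) \<Longrightarrow> \<Union>T = x"
  by blast

text \<open>The product of two jointly monic spans is jointly monic, so \<open>span_rel\<close>
  applies. The resulting condition mentions \<open>R\<close> and \<open>S\<close> only through
  \<open>holds\<close>, hence is the same for all representatives.\<close>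

lemma tensor_rel:
  assumes R: "R \<in> hom (Rel C P) a1 b1" and S: "S \<in> hom (Rel C P) a2 b2"
  shows "tensor (Rel C P) R S \<in> hom (Rel C P) (prod P a1 a2) (prod P b1 b2)"
    and "\<lbrakk>u \<in> hom C d (prod P a1 a2); v \<in> hom C d (prod P b1 b2)\<rbrakk> \<Longrightarrow>
      holds (tensor (Rel C P) R S) u v \<longleftrightarrow>
        holds R (u \<Zsemi> proj1 P a1 a2) (v \<Zsemi> proj1 P b1 b2) \<and>
        holds S (u \<Zsemi> proj2 P a1 a2) (v \<Zsemi> proj2 P b1 b2)"
proof -
  obtain X where X: "R = (a1, b1, X)" "X \<in> subobjects C (prod P a1 b1)"
    and o1: "a1 \<in> Obj C" "b1 \<in> Obj C"
    using rel_homE[OF R] .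
  obtain Y where Y: "S = (a2, b2, Y)" "Y \<in> subobjects C (prod P a2 b2)"
    and o2: "a2 \<in> Obj C" "b2 \<in> Obj C"
    using rel_homE[OF S] .
  define mx where "mx x y =
      (let p = proj1 P (Dom C x) (Dom C y); q = proj2 P (Dom C x) (Dom C y) in
          \<langle>\<langle>p \<Zsemi> x \<Zsemi> proj1 P a1 b1, q \<Zsemi> y \<Zsemi> proj1 P a2 b2\<rangle>, \<langle>p \<Zsemi> x \<Zsemi> proj2 P a1 b1, q \<Zsemi> y \<Zsemi> proj2 P a2 b2\<rangle>\<rangle>)"
    for x y
  let ?A = "prod P a1 a2" and ?B = "prod P b1 b2"
  have key: "(?A, ?B, subobject_of C (mx x y)) \<in> hom (Rel C P) ?A ?B \<and>
      (\<forall>d. \<forall>u \<in> hom C d ?A. \<forall>v \<in> hom C d ?B. holds (?A, ?B, subobject_of C (mx x y)) u v \<longleftrightarrow>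
        holds R (u \<Zsemi> proj1 P a1 a2) (v \<Zsemi> proj1 P b1 b2) \<and>
        holds S (u \<Zsemi> proj2 P a1 a2) (v \<Zsemi> proj2 P b1 b2))"
    if x: "x \<in> X" and y: "y \<in> Y" for x y
  proof -
    note xr = rel_representative[OF R[unfolded X(1)] x]
    note yr = rel_representative[OF S[unfolded Y(1)] y]
    define n where "n = Dom C x"
    define k where "k = Dom C y"
    define s where "s = x \<Zsemi> proj1 P a1 b1"
    define t where "t = x \<Zsemi> proj2 P a1 b1"
    define s' where "s' = y \<Zsemi> proj1 P a2 b2"
    define t' where "t' = y \<Zsemi> proj2 P a2 b2"
    define p where "p = proj1 P n k"
    define q where "q = proj2 P n k"
    note [folded n_def s_def t_def] = xr
    note xr = this[folded X(1)]
    note [folded k_def s'_def t'_def] = yr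
    note yr = this[folded Y(1)]
    have nk: "n \<in> Obj C" "k \<in> Obj C" using xr(1) yr(1) by (auto simp: hom_iff)
    have p: "p \<in> hom C (prod P n k) n" and q: "q \<in> hom C (prod P n k) k"
      unfolding p_def q_def using proj_hom[OF nk] .
    have xh: "x \<in> hom C n (prod P a1 b1)" and yh: "y \<in> hom C k (prod P a2 b2)"
      using subobject_member(2)[OF X(2) x] subobject_member(2)[OF Y(2) y]
      unfolding n_def k_def .
    \<comment> \<open>Regrouping the composites exposes the legs \<open>s\<close>, \<open>t\<close>
      of \<open>x\<close> and \<open>s'\<close>, \<open>t'\<close> of \<open>y\<close>, to which
      joint monicity refers.\<close>
    have mxy: "mx x y = \<langle>\<langle>p \<Zsemi> s, q \<Zsemi> s'\<rangle>, \<langle>p \<Zsemi> t, q \<Zsemi> t'\<rangle>\<rangle>"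
      unfolding mx_def Let_def s_def t_def s'_def t'_def n_def[symmetric] k_def[symmetric]
        p_def[symmetric] q_def[symmetric]
      using comp_assoc[OF p xh proj_hom(1)[OF o1]] comp_assoc[OF q yh proj_hom(1)[OF o2]]
        comp_assoc[OF p xh proj_hom(2)[OF o1]] comp_assoc[OF q yh proj_hom(2)[OF o2]] by simp
    note ps = comp_hom[OF p xr(1)] comp_hom[OF p xr(2)] comp_hom[OF q yr(1)] comp_hom[OF q yr(2)]
    note f = pairing_hom[OF ps(1,3)] and g = pairing_hom[OF ps(2,4)]
    have as: "w \<Zsemi> (p \<Zsemi> s) = (w \<Zsemi> p) \<Zsemi> s" "w \<Zsemi> (p \<Zsemi> t) = (w \<Zsemi> p) \<Zsemi> t"
        "w \<Zsemi> (q \<Zsemi> s') = (w \<Zsemi> q) \<Zsemi> s'" "w \<Zsemi> (q \<Zsemi> t') = (w \<Zsemi> q) \<Zsemi> t'"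
      if "w \<in> hom C d (prod P n k)" for d w
      using comp_assoc[OF that p] comp_assoc[OF that q] xr(1,2) yr(1,2) by metis+
    \<comment> \<open>The four components determine \<open>u \<Zsemi> p\<close> through the legs of
      \<open>x\<close> and \<open>u \<Zsemi> q\<close> through those of \<open>y\<close>, and these
      two determine \<open>u\<close>.\<close>
    have m: "monic C (mx x y)" unfolding mxy
    proof (rule monic_pairing[OF f(1) g(1)])
      fix d u v assume uv: "u \<in> hom C d (prod P n k)" "v \<in> hom C d (prod P n k)"
        and 1: "u \<Zsemi> \<langle>p \<Zsemi> s, q \<Zsemi> s'\<rangle> = v \<Zsemi> \<langle>p \<Zsemi> s, q \<Zsemi> s'\<rangle>"
        and 2: "u \<Zsemi> \<langle>p \<Zsemi> t, q \<Zsemi> t'\<rangle> = v \<Zsemi> \<langle>p \<Zsemi> t, q \<Zsemi> t'\<rangle>"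
      have "u \<Zsemi> (p \<Zsemi> s) = v \<Zsemi> (p \<Zsemi> s) \<and> u \<Zsemi> (q \<Zsemi> s') = v \<Zsemi> (q \<Zsemi> s')"
        using 1 unfolding comp_pairing[OF uv(1) ps(1,3)] comp_pairing[OF uv(2) ps(1,3)]
          pairing_eq_iff[OF comp_hom[OF uv(1) ps(1)] comp_hom[OF uv(1) ps(3)]
            comp_hom[OF uv(2) ps(1)] comp_hom[OF uv(2) ps(3)]] .
      moreover have "u \<Zsemi> (p \<Zsemi> t) = v \<Zsemi> (p \<Zsemi> t) \<and> u \<Zsemi> (q \<Zsemi> t') = v \<Zsemi> (q \<Zsemi> t')"
        using 2 unfolding comp_pairing[OF uv(1) ps(2,4)] comp_pairing[OF uv(2) ps(2,4)]
          pairing_eq_iff[OF comp_hom[OF uv(1) ps(2)] comp_hom[OF uv(1) ps(4)]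
            comp_hom[OF uv(2) ps(2)] comp_hom[OF uv(2) ps(4)]] .
      ultimately have "u \<Zsemi> p = v \<Zsemi> p" "u \<Zsemi> q = v \<Zsemi> q"
        using xr(4)[OF comp_hom[OF uv(1) p] comp_hom[OF uv(2) p]]
          yr(4)[OF comp_hom[OF uv(1) q] comp_hom[OF uv(2) q]]
        unfolding as[OF uv(1)] as[OF uv(2)] by simp_all
      then show "u = v" using prod_arr_eqI[OF uv nk] unfolding p_def q_def by simp
    qed
    have "holds (?A, ?B, subobject_of C (mx x y)) u v \<longleftrightarrow>
        holds R (u \<Zsemi> proj1 P a1 a2) (v \<Zsemi> proj1 P b1 b2) \<and>
        holds S (u \<Zsemi> proj2 P a1 a2) (v \<Zsemi> proj2 P b1 b2)"
      if u: "u \<in> hom C d ?A" and v: "v \<in> hom C d ?B" for d u v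
    proof -
      note up = comp_hom[OF u proj_hom(1)[OF o1(1) o2(1)]] comp_hom[OF u proj_hom(2)[OF o1(1) o2(1)]]
      note vp = comp_hom[OF v proj_hom(1)[OF o1(2) o2(2)]] comp_hom[OF v proj_hom(2)[OF o1(2) o2(2)]]
      have "w \<Zsemi> \<langle>p \<Zsemi> s, q \<Zsemi> s'\<rangle> = u \<and> w \<Zsemi> \<langle>p \<Zsemi> t, q \<Zsemi> t'\<rangle> = v \<longleftrightarrow>
          (w \<Zsemi> p) \<Zsemi> s = u \<Zsemi> proj1 P a1 a2 \<and> (w \<Zsemi> q) \<Zsemi> s' = u \<Zsemi> proj2 P a1 a2 \<and>
          (w \<Zsemi> p) \<Zsemi> t = v \<Zsemi> proj1 P b1 b2 \<and> (w \<Zsemi> q) \<Zsemi> t' = v \<Zsemi> proj2 P b1 b2"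
        if w: "w \<in> hom C d (prod P n k)" for w
        unfolding comp_pairing[OF w ps(1,3)] comp_pairing[OF w ps(2,4)]
        using eq_pairing_iff[OF u comp_hom[OF w ps(1)] comp_hom[OF w ps(3)]]
          eq_pairing_iff[OF v comp_hom[OF w ps(2)] comp_hom[OF w ps(4)]] as[OF w] by metis
      then have "holds (?A, ?B, subobject_of C (mx x y)) u v \<longleftrightarrow>
          (\<exists>w \<in> hom C d (prod P n k).
            (w \<Zsemi> p) \<Zsemi> s = u \<Zsemi> proj1 P a1 a2 \<and> (w \<Zsemi> q) \<Zsemi> s' = u \<Zsemi> proj2 P a1 a2 \<and>
            (w \<Zsemi> p) \<Zsemi> t = v \<Zsemi> proj1 P b1 b2 \<and> (w \<Zsemi> q) \<Zsemi> t' = v \<Zsemi> proj2 P b1 b2)"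
        using span_rel(2)[OF f(1) g(1) m[unfolded mxy] u v] unfolding mxy by simp
      \<comment> \<open>An element of the product of the two apexes is a pair of independent
        witnesses, so the existential quantifier splits.\<close>
      also have "\<dots> \<longleftrightarrow>
          (\<exists>w1 \<in> hom C d n. w1 \<Zsemi> s = u \<Zsemi> proj1 P a1 a2 \<and> w1 \<Zsemi> t = v \<Zsemi> proj1 P b1 b2) \<and>
          (\<exists>w2 \<in> hom C d k. w2 \<Zsemi> s' = u \<Zsemi> proj2 P a1 a2 \<and> w2 \<Zsemi> t' = v \<Zsemi> proj2 P b1 b2)"
        (is "?L \<longleftrightarrow> ?R")
      proof
        assume ?L then show ?R using comp_hom[OF _ p] comp_hom[OF _ q] by blast
      next
        assume ?R
        then obtain w1 w2 where w: "w1 \<in> hom C d n" "w2 \<in> hom C d k"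
          "w1 \<Zsemi> s = u \<Zsemi> proj1 P a1 a2" "w1 \<Zsemi> t = v \<Zsemi> proj1 P b1 b2"
          "w2 \<Zsemi> s' = u \<Zsemi> proj2 P a1 a2" "w2 \<Zsemi> t' = v \<Zsemi> proj2 P b1 b2" by blast
        then show ?L using pairing_hom[OF w(1,2)] unfolding p_def q_def
          by (intro bexI[of _ "\<langle>w1, w2\<rangle>"]) simp_all
      qed
      finally show ?thesis using xr(3)[OF up(1) vp(1)] yr(3)[OF up(2) vp(2)] by blast
    qed
    then show ?thesis using span_rel(1)[OF f(1) g(1) m[unfolded mxy]] unfolding mxy by blast
  qed
  obtain x0 where x0: "x0 \<in> X" using X(2) subobjectE by metis
  obtain y0 where y0: "y0 \<in> Y" using Y(2) subobjectE by metis
  have "subobject_of C (mx x y) = subobject_of C (mx x0 y0)" if "x \<in> X" "y \<in> Y" for x y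
    using rel_eqI[OF conjunct1[OF key[OF that]] conjunct1[OF key[OF x0 y0]]]
      key[OF that] key[OF x0 y0] by simp
  then have "\<Union>{subobject_of C (mx x y) | x y. x \<in> X \<and> y \<in> Y} = subobject_of C (mx x0 y0)"
    using x0 y0 by (intro Union_eq_if_all_eq) blast+
  then have eq: "tensor (Rel C P) R S = (?A, ?B, subobject_of C (mx x0 y0))"
    unfolding Rel_simps X Y rel_tensor.simps mx_def Let_def by simp
  show "tensor (Rel C P) R S \<in> hom (Rel C P) ?A ?B" unfolding eq using key[OF x0 y0] by blast
  assume "u \<in> hom C d ?A" "v \<in> hom C d ?B"
  then show "holds (tensor (Rel C P) R S) u v \<longleftrightarrow>
        holds R (u \<Zsemi> proj1 P a1 a2) (v \<Zsemi> proj1 P b1 b2) \<and>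
        holds S (u \<Zsemi> proj2 P a1 a2) (v \<Zsemi> proj2 P b1 b2)"
    unfolding eq using key[OF x0 y0] by blast
qed

text \<open>An element of the pullback is a pair of witnesses for \<open>R\<close> and
  \<open>S\<close> that agree in \<open>b\<close>; their common value is the middle element
  \<open>g\<close>. The image then adds the cover \<open>e\<close>. No choice of \<open>x\<close>,
  \<open>y\<close>, \<open>p\<close>, \<open>q\<close> is left in this description, so all choices
  agree.\<close>

lemma comp_rel:
  assumes R: "R \<in> hom (Rel C P) a b" and S: "S \<in> hom (Rel C P) b c"
  shows "comp (Rel C P) R S \<in> hom (Rel C P) a c"
    and "\<lbrakk>u \<in> hom C d a; v \<in> hom C d c\<rbrakk> \<Longrightarrow> holds (comp (Rel C P) R S) u v \<longleftrightarrow>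
      (\<exists>d'. \<exists>e \<in> hom C d' d. regular_epi C e \<and>
        (\<exists>g \<in> hom C d' b. holds R (e \<Zsemi> u) g \<and> holds S g (e \<Zsemi> v)))"
proof -
  obtain X where X: "R = (a, b, X)" "X \<in> subobjects C (prod P a b)"
    and ab: "a \<in> Obj C" "b \<in> Obj C"
    using rel_homE[OF R] .
  obtain Y where Y: "S = (b, c, Y)" "Y \<in> subobjects C (prod P b c)" and c: "c \<in> Obj C"
    using rel_homE[OF S] .
  define k where "k x y p q = \<langle>p \<Zsemi> x \<Zsemi> proj1 P a b, q \<Zsemi> y \<Zsemi> proj2 P b c\<rangle>" for x y p q
  have key: "(a, c, image_subobject C (k x y p q)) \<in> hom (Rel C P) a c \<and>
      (\<forall>d. \<forall>u \<in> hom C d a. \<forall>v \<in> hom C d c. holds (a, c, image_subobject C (k x y p q)) u v \<longleftrightarrow>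
        (\<exists>d'. \<exists>e \<in> hom C d' d. regular_epi C e \<and>
          (\<exists>g \<in> hom C d' b. holds R (e \<Zsemi> u) g \<and> holds S g (e \<Zsemi> v))))"
    if x: "x \<in> X" and y: "y \<in> Y" and pq: "is_pullback C (x \<Zsemi> proj2 P a b) (y \<Zsemi> proj1 P b c) p q"
    for x y p q
  proof -
    note xr = rel_representative[OF R[unfolded X(1)] x, folded X(1)]
    note yr = rel_representative[OF S[unfolded Y(1)] y, folded Y(1)]
    define s where "s = x \<Zsemi> proj1 P a b"
    define t where "t = x \<Zsemi> proj2 P a b"
    define s' where "s' = y \<Zsemi> proj1 P b c"
    define t' where "t' = y \<Zsemi> proj2 P b c"
    note xr = xr[folded s_def t_def] and yr = yr[folded s'_def t'_def]
    obtain l where p: "p \<in> hom C l (Dom C x)" and q: "q \<in> hom C l (Dom C y)"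
      and sq: "p \<Zsemi> t = q \<Zsemi> s'"
      and univ: "\<forall>d. \<forall>u \<in> hom C d (Dom C x). \<forall>v \<in> hom C d (Dom C y). u \<Zsemi> t = v \<Zsemi> s' \<longrightarrow>
         (\<exists>h \<in> hom C d l. h \<Zsemi> p = u \<and> h \<Zsemi> q = v)"
      using pullbackE[OF pq[folded t_def s'_def] xr(2) yr(1)] .
    note xh = subobject_member(2)[OF X(2) x] and yh = subobject_member(2)[OF Y(2) y]
    note ps = comp_hom[OF p xr(1)] and qt = comp_hom[OF q yr(2)]
    have keq: "k x y p q = \<langle>p \<Zsemi> s, q \<Zsemi> t'\<rangle>"
      unfolding k_def s_def t'_def
      using comp_assoc[OF p xh proj_hom(1)[OF ab]] comp_assoc[OF q yh proj_hom(2)[OF ab(2) c]]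
      by simp
    have kh: "k x y p q \<in> hom C l (prod P a c)" unfolding keq by (rule pairing_hom(1)[OF ps qt])
    have "holds (a, c, image_subobject C (k x y p q)) u v \<longleftrightarrow>
        (\<exists>d'. \<exists>e \<in> hom C d' d. regular_epi C e \<and>
          (\<exists>g \<in> hom C d' b. holds R (e \<Zsemi> u) g \<and> holds S g (e \<Zsemi> v)))"
      if u: "u \<in> hom C d a" and v: "v \<in> hom C d c" for d u v
    proof -
      \<comment> \<open>On a fixed cover the image no longer intervenes, and the claim concerns
        elements of the pullback only.\<close>
      have "factors_through C (e \<Zsemi> \<langle>u, v\<rangle>) (k x y p q) \<longleftrightarrow>
          (\<exists>g \<in> hom C d' b. holds R (e \<Zsemi> u) g \<and> holds S g (e \<Zsemi> v))"
        if e: "e \<in> hom C d' d" for d' e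
      proof -
        note eu = comp_hom[OF e u] and ev = comp_hom[OF e v]
        have "factors_through C (e \<Zsemi> \<langle>u, v\<rangle>) (k x y p q) \<longleftrightarrow>
            (\<exists>w \<in> hom C d' l. w \<Zsemi> (p \<Zsemi> s) = e \<Zsemi> u \<and> w \<Zsemi> (q \<Zsemi> t') = e \<Zsemi> v)"
          unfolding keq comp_pairing[OF e u v] by (rule factors_through_pairing[OF eu ev ps qt])
        also have "\<dots> \<longleftrightarrow> (\<exists>g \<in> hom C d' b. holds R (e \<Zsemi> u) g \<and> holds S g (e \<Zsemi> v))"
        proof
          assume "\<exists>w \<in> hom C d' l. w \<Zsemi> (p \<Zsemi> s) = e \<Zsemi> u \<and> w \<Zsemi> (q \<Zsemi> t') = e \<Zsemi> v"
          then obtain w where w: "w \<in> hom C d' l" "w \<Zsemi> (p \<Zsemi> s) = e \<Zsemi> u" "w \<Zsemi> (q \<Zsemi> t') = e \<Zsemi> v"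
            by blast
          note wp = comp_hom[OF w(1) p] and wq = comp_hom[OF w(1) q]
          have "(w \<Zsemi> p) \<Zsemi> s = e \<Zsemi> u" "(w \<Zsemi> q) \<Zsemi> t' = e \<Zsemi> v"
            using w comp_assoc[OF w(1) p xr(1)] comp_assoc[OF w(1) q yr(2)] by simp_all
          moreover have "(w \<Zsemi> p) \<Zsemi> t = (w \<Zsemi> q) \<Zsemi> s'"
            using comp_assoc[OF w(1) p xr(2)] comp_assoc[OF w(1) q yr(1)] sq by simp
          moreover note g = comp_hom[OF wp xr(2)]
          ultimately have "holds R (e \<Zsemi> u) ((w \<Zsemi> p) \<Zsemi> t)" "holds S ((w \<Zsemi> p) \<Zsemi> t) (e \<Zsemi> v)"
            using xr(3)[OF eu g] yr(3)[OF g ev] wp wq by auto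
          then show "\<exists>g \<in> hom C d' b. holds R (e \<Zsemi> u) g \<and> holds S g (e \<Zsemi> v)" using g by blast
        next
          assume "\<exists>g \<in> hom C d' b. holds R (e \<Zsemi> u) g \<and> holds S g (e \<Zsemi> v)"
          then obtain g where g: "g \<in> hom C d' b" "holds R (e \<Zsemi> u) g" "holds S g (e \<Zsemi> v)" by blast
          obtain w1 where w1: "w1 \<in> hom C d' (Dom C x)" "w1 \<Zsemi> s = e \<Zsemi> u" "w1 \<Zsemi> t = g"
            using xr(3)[OF eu g(1)] g(2) by blast
          obtain w2 where w2: "w2 \<in> hom C d' (Dom C y)" "w2 \<Zsemi> s' = g" "w2 \<Zsemi> t' = e \<Zsemi> v"
            using yr(3)[OF g(1) ev] g(3) by blast
          obtain w where w: "w \<in> hom C d' l" "w \<Zsemi> p = w1" "w \<Zsemi> q = w2"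
            using univ w1 w2 by metis
          then have "w \<Zsemi> (p \<Zsemi> s) = e \<Zsemi> u \<and> w \<Zsemi> (q \<Zsemi> t') = e \<Zsemi> v"
            using w1 w2 comp_assoc[OF w(1) p xr(1)] comp_assoc[OF w(1) q yr(2)] by simp
          then show "\<exists>w \<in> hom C d' l. w \<Zsemi> (p \<Zsemi> s) = e \<Zsemi> u \<and> w \<Zsemi> (q \<Zsemi> t') = e \<Zsemi> v"
            using w(1) by blast
        qed
        finally show ?thesis .
      qed
      then show ?thesis
        using image_subobject_subobjects(2)[OF kh pairing_hom(1)[OF u v]]
        unfolding holds_def snd_conv by blast
    qed
    then show ?thesis
      using image_subobject_subobjects(1)[OF kh] ab c by (simp add: rel_hom_iff)
  qed
  obtain x0 where x0: "x0 \<in> X" using X(2) subobjectE by metis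
  obtain y0 where y0: "y0 \<in> Y" using Y(2) subobjectE by metis
  obtain p0 q0 where pq0: "is_pullback C (x0 \<Zsemi> proj2 P a b) (y0 \<Zsemi> proj1 P b c) p0 q0"
    using pullback_exists[OF rel_representative(2)[OF R[unfolded X(1)] x0]
        rel_representative(1)[OF S[unfolded Y(1)] y0]] by blast
  note key0 = key[OF x0 y0 pq0]
  \<comment> \<open>Different choices have equal elements by \<open>key\<close>, so extensionality
    replaces any comparison of pullbacks.\<close>
  have "image_subobject C (k x y p q) = image_subobject C (k x0 y0 p0 q0)"
    if "x \<in> X" "y \<in> Y" "is_pullback C (x \<Zsemi> proj2 P a b) (y \<Zsemi> proj1 P b c) p q" for x y p q
    using rel_eqI[OF conjunct1[OF key[OF that]] conjunct1[OF key0]] key[OF that] key0 by simp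
  then have "\<Union>{image_subobject C (k x y p q) | x y p q.
      x \<in> X \<and> y \<in> Y \<and> is_pullback C (x \<Zsemi> proj2 P a b) (y \<Zsemi> proj1 P b c) p q}
    = image_subobject C (k x0 y0 p0 q0)"
    using x0 y0 pq0 by (intro Union_eq_if_all_eq) blast+
  then have eq: "comp (Rel C P) R S = (a, c, image_subobject C (k x0 y0 p0 q0))"
    unfolding Rel_simps X Y rel_comp.simps k_def by simp
  show "comp (Rel C P) R S \<in> hom (Rel C P) a c" unfolding eq using key0 by blast
  assume "u \<in> hom C d a" "v \<in> hom C d c"
  then show "holds (comp (Rel C P) R S) u v \<longleftrightarrow>
      (\<exists>d'. \<exists>e \<in> hom C d' d. regular_epi C e \<and>
        (\<exists>g \<in> hom C d' b. holds R (e \<Zsemi> u) g \<and> holds S g (e \<Zsemi> v)))"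
    unfolding eq using key0 by blast
qed

lemma comp_relI:
  assumes "R \<in> hom (Rel C P) a b" "S \<in> hom (Rel C P) b c"
    and "u \<in> hom C d a" "g \<in> hom C d b" "v \<in> hom C d c" "holds R u g" "holds S g v"
  shows "holds (comp (Rel C P) R S) u v"
proof -
  have d: "d \<in> Obj C" using assms(3) by (simp add: hom_iff)
  then show ?thesis
    using comp_rel(2)[OF assms(1,2,3,5)] regular_epi_ident[OF d] ident_hom[OF d] assms(4,6,7)
      ident_left[OF assms(3)] ident_left[OF assms(5)] by metis
qed

lemma comp_relE:
  assumes "R \<in> hom (Rel C P) a b" "S \<in> hom (Rel C P) b c"
    and "u \<in> hom C d a" "v \<in> hom C d c" "holds (comp (Rel C P) R S) u v"
  obtains d' e g where "regular_epi C e" "e \<in> hom C d' d" "g \<in> hom C d' b"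
    "holds R (e \<Zsemi> u) g" "holds S g (e \<Zsemi> v)"
  using assms(5) unfolding comp_rel(2)[OF assms(1-4)] by blast

text \<open>The middle element on a cover is forced to be the restriction of
  \<open>v \<Zsemi> f\<close>, which exists over \<open>d\<close> already; descent therefore removes
  the cover.\<close>

lemma holds_comp_cograph:
  assumes R: "R \<in> hom (Rel C P) a b" and f: "f \<in> hom C c b"
    and u: "u \<in> hom C d a" and v: "v \<in> hom C d c"
  shows "holds (comp (Rel C P) R (cograph f)) u v \<longleftrightarrow> holds R u (v \<Zsemi> f)"
proof
  note F = cograph_rel[OF f] and vf = comp_hom[OF v f]
  show "holds (comp (Rel C P) R (cograph f)) u v" if "holds R u (v \<Zsemi> f)"
    using comp_relI[OF R F(1) u vf v that] F(2)[OF vf v] by simp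
  assume "holds (comp (Rel C P) R (cograph f)) u v"
  then obtain d' e g where e: "regular_epi C e" "e \<in> hom C d' d" and g: "g \<in> hom C d' b"
      "holds R (e \<Zsemi> u) g" "holds (cograph f) g (e \<Zsemi> v)"
    by (rule comp_relE[OF R F(1) u v])
  have "g = e \<Zsemi> (v \<Zsemi> f)"
    using g(3) F(2)[OF g(1) comp_hom[OF e(2) v]] comp_assoc[OF e(2) v f] by simp
  then show "holds R u (v \<Zsemi> f)" using holds_descent[OF R u vf e] g(2) by simp
qed

text \<open>Here the graph forces the middle element to be the restriction of
  \<open>u \<Zsemi> f\<close>, and the cover disappears in the same way.\<close>

lemma holds_graph_comp:
  assumes f: "f \<in> hom C a b" and S: "S \<in> hom (Rel C P) b c"
    and u: "u \<in> hom C d a" and v: "v \<in> hom C d c"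
  shows "holds (comp (Rel C P) (rel_graph C P f) S) u v \<longleftrightarrow> holds S (u \<Zsemi> f) v"
proof
  note F = graph_rel[OF f] and uf = comp_hom[OF u f]
  show "holds (comp (Rel C P) (rel_graph C P f) S) u v" if "holds S (u \<Zsemi> f) v"
    using comp_relI[OF F(1) S u uf v _ that] F(2)[OF u uf] by simp
  assume "holds (comp (Rel C P) (rel_graph C P f) S) u v"
  then obtain d' e g where e: "regular_epi C e" "e \<in> hom C d' d" and g: "g \<in> hom C d' b"
      "holds (rel_graph C P f) (e \<Zsemi> u) g" "holds S g (e \<Zsemi> v)"
    by (rule comp_relE[OF F(1) S u v])
  have "g = e \<Zsemi> (u \<Zsemi> f)"
    using g(2) F(2)[OF comp_hom[OF e(2) u] g(1)] comp_assoc[OF e(2) u f] by simp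
  then show "holds S (u \<Zsemi> f) v" using holds_descent[OF S uf v e] g(3) by simp
qed

section \<open>The adjoint monoid structure\<close>

text \<open>The left adjoint is the graph of \<open>f\<close>. The unit says that \<open>f\<close>
  is defined everywhere. The counit says that it is single-valued: on a cover \<open>u\<close> and
  \<open>v\<close> are both the value of \<open>f\<close> at \<open>g\<close>, and regular
  epimorphisms cancel.\<close>

lemma right_adjoint_cograph:
  assumes f: "f \<in> hom C a b"
  shows "right_adjoint (Rel C P) (cograph f)"
proof -
  note F = cograph_rel[OF f] and G = graph_rel[OF f]
  have ab: "a \<in> Obj C" "b \<in> Obj C" using f by (auto simp: hom_iff)
  have "le (Rel C P) (ident (Rel C P) a) (comp (Rel C P) (rel_graph C P f) (cograph f))"
    unfolding rel_le_iff[OF ident_rel(1)[OF ab(1)] comp_rel(1)[OF G(1) F(1)]]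
    using ident_rel(2)[OF ab(1)] holds_comp_cograph[OF G(1) f] G(2) comp_hom[OF _ f] by simp
  moreover have "le (Rel C P) (comp (Rel C P) (cograph f) (rel_graph C P f)) (ident (Rel C P) b)"
    unfolding rel_le_iff[OF comp_rel(1)[OF F(1) G(1)] ident_rel(1)[OF ab(2)]]
  proof (intro allI ballI impI)
    fix d u v assume u: "u \<in> hom C d b" and v: "v \<in> hom C d b"
      and "holds (comp (Rel C P) (cograph f) (rel_graph C P f)) u v"
    then obtain d' e g where e: "regular_epi C e" "e \<in> hom C d' d" and g: "g \<in> hom C d' a"
        "holds (cograph f) (e \<Zsemi> u) g" "holds (rel_graph C P f) g (e \<Zsemi> v)"
      using comp_relE[OF F(1) G(1)] by metis
    have "e \<Zsemi> u = e \<Zsemi> v"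
      using g F(2)[OF comp_hom[OF e(2) u] g(1)] G(2)[OF g(1) comp_hom[OF e(2) v]] by simp
    moreover have "Cod C e = d" using e by (simp add: hom_iff)
    ultimately have "u = v" using regular_epi_cancel[OF e(1)] u v by blast
    then show "holds (ident (Rel C P) b) u v" using ident_rel(2)[OF ab(2) u v] by simp
  qed
  moreover have "cograph f \<in> Arr (Rel C P)"
      "Dom (Rel C P) (cograph f) = b" "Cod (Rel C P) (cograph f) = a"
    using F(1) by (simp_all add: hom_def)
  ultimately show ?thesis using G(1) unfolding right_adjoint_def by auto
qed

text \<open>The unit puts the pair \<open>v\<close>, \<open>v\<close> into
  \<open>L \<Zsemi> R\<close>, and the middle element of that composite is the required
  \<open>g\<close>. Totality is on the side of the codomain: each of its elements is reached
  locally.\<close>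

lemma right_adjoint_total:
  assumes R: "right_adjoint (Rel C P) R" "R \<in> hom (Rel C P) a b" and v: "v \<in> hom C d b"
  obtains d' e g where "regular_epi C e" "e \<in> hom C d' d" "g \<in> hom C d' a" "holds R g (e \<Zsemi> v)"
proof -
  have "b \<in> Obj C" using v by (simp add: hom_iff)
  note id = ident_rel[OF this]
  obtain L where L: "L \<in> hom (Rel C P) b a"
      "le (Rel C P) (ident (Rel C P) b) (comp (Rel C P) L R)"
    using R unfolding right_adjoint_def by (auto simp: hom_def)
  have "holds (comp (Rel C P) L R) v v"
    using L(2) id(2)[OF v v] v unfolding rel_le_iff[OF id(1) comp_rel(1)[OF L(1) R(2)]] by blast
  then show thesis using comp_relE[OF L(1) R(2) v v] that by metis
qed

section \<open>Existence: converses of the diagonal and of the terminal arrow\<close>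

lemma terminal_obj: "terminal P \<in> Obj C"
  and bang_exists: "a \<in> Obj C \<Longrightarrow> \<exists>t. t \<in> hom C a (terminal P)"
  and bang_unique: "s \<in> hom C a (terminal P) \<Longrightarrow> t \<in> hom C a (terminal P) \<Longrightarrow> s = t"
  using products unfolding chosen_products_def is_terminal_def by (auto simp: hom_iff)

lemma diagonal:
  assumes "c \<in> Obj C"
  shows "\<langle>\<one> c, \<one> c\<rangle> \<in> hom C c (prod P c c)"
    and "g \<in> hom C d c \<Longrightarrow> g \<Zsemi> \<langle>\<one> c, \<one> c\<rangle> = \<langle>g, g\<rangle>"
  using pairing_hom(1) comp_pairing ident_hom[OF assms] ident_right by metis+

text \<open>Composing with the multiplication evaluates the preceding relation at
  \<open>\<langle>g, g\<rangle>\<close>. Each law thereby becomes the statement that certain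
  components of \<open>u\<close> all equal \<open>g\<close>, and the two sides differ only in
  bracketing or order.\<close>

lemma adjoint_monoid_exists:
  assumes c: "c \<in> Obj C" and t: "t \<in> hom C c (terminal P)"
  shows "adjoint_monoid (Rel C P) c (cograph \<langle>\<one> c, \<one> c\<rangle>) (cograph t)"
proof -
  let ?M = "Rel C P" and ?\<mu> = "cograph \<langle>\<one> c, \<one> c\<rangle>" and ?\<eta> = "cograph t"
  let ?p1 = "proj1 P" and ?p2 = "proj2 P" and ?cc = "prod P c c" and ?I = "terminal P"
  note D = diagonal(1)[OF c] and D' = diagonal(2)[OF c]
  note \<mu> = cograph_rel[OF D] and \<eta> = cograph_rel[OF t] and id = ident_rel[OF c]
  have ob: "?cc \<in> Obj C" "?I \<in> Obj C" using D terminal_obj by (auto simp: hom_iff)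
  note pcc = proj_hom[OF c c]
  have \<mu>_iff: "holds ?\<mu> u g \<longleftrightarrow> u \<Zsemi> ?p1 c c = g \<and> u \<Zsemi> ?p2 c c = g"
    if "u \<in> hom C d ?cc" "g \<in> hom C d c" for d u g
    using \<mu>(2)[OF that] D'[OF that(2)] eq_pairing_iff[OF that(1) that(2) that(2)] by auto
  \<comment> \<open>Both arrows to be compared end in the terminal object, so this relation holds of
    everything.\<close>
  have \<eta>_iff: "holds ?\<eta> u g" if "u \<in> hom C d ?I" "g \<in> hom C d c" for d u g
    using \<eta>(2)[OF that] bang_unique comp_hom[OF that(2) t] that(1) by blast
  have comp_\<mu>: "holds (comp ?M R ?\<mu>) u g \<longleftrightarrow> holds R u \<langle>g, g\<rangle>"
    if "R \<in> hom ?M a ?cc" "u \<in> hom C d a" "g \<in> hom C d c" for R a u d g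
    using holds_comp_cograph[OF that(1) D that(2,3)] D'[OF that(3)] by simp
  have gg: "\<langle>g, g\<rangle> \<in> hom C d ?cc" "\<langle>g, g\<rangle> \<Zsemi> ?p1 c c = g" "\<langle>g, g\<rangle> \<Zsemi> ?p2 c c = g"
    if "g \<in> hom C d c" for d g
    using pairing_hom[OF that that] .
  let ?\<mu>L = "tensor ?M ?\<mu> (ident ?M c)" and ?\<mu>R = "tensor ?M (ident ?M c) ?\<mu>"
  let ?\<eta>L = "tensor ?M ?\<eta> (ident ?M c)" and ?\<eta>R = "tensor ?M (ident ?M c) ?\<eta>"
  note \<mu>1 = tensor_rel[OF \<mu>(1) id(1)] and \<mu>2 = tensor_rel[OF id(1) \<mu>(1)]
  note \<eta>1 = tensor_rel[OF \<eta>(1) id(1)] and \<eta>2 = tensor_rel[OF id(1) \<eta>(1)]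
  have "comp ?M ?\<mu>L ?\<mu> = comp ?M (comp ?M (associator ?M c c c) ?\<mu>R) ?\<mu>"
  proof -
    define p where "p = ?p1 ?cc c"
    define q where "q = ?p2 ?cc c"
    have pq: "p \<in> hom C (prod P ?cc c) ?cc" "q \<in> hom C (prod P ?cc c) c"
      unfolding p_def q_def using proj_hom[OF ob(1) c] .
    note pp = comp_hom[OF pq(1) pcc(1)] comp_hom[OF pq(1) pcc(2)]
    \<comment> \<open>\<open>s\<close> is the inner and \<open>a\<close> the outer pairing of the
      associator of \<open>C\<close>; \<open>us1\<close>, \<open>us2\<close>, \<open>ua1\<close> and
      \<open>ua2\<close> below compute their components at \<open>u\<close>.\<close>
    define s where "s = \<langle>p \<Zsemi> ?p2 c c, q\<rangle>"
    define a where "a = \<langle>p \<Zsemi> ?p1 c c, s\<rangle>"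
    note s = pairing_hom[OF pp(2) pq(2), folded s_def]
    note a = pairing_hom[OF pp(1) s(1), folded a_def]
    have assoc_eq: "associator ?M c c c = rel_graph C P a"
      by (simp add: Rel_def a_def s_def p_def q_def)
    note G = graph_rel[OF a(1)]
    show ?thesis unfolding assoc_eq
    proof (rule rel_eqI[OF comp_rel(1)[OF \<mu>1(1) \<mu>(1)] comp_rel(1)[OF comp_rel(1)[OF G(1) \<mu>2(1)] \<mu>(1)]])
      fix d u g assume u: "u \<in> hom C d (prod P ?cc c)" and g: "g \<in> hom C d c"
      note ua = comp_hom[OF u a(1)] and up = comp_hom[OF u pq(1)] and uq = comp_hom[OF u pq(2)]
      have "holds (comp ?M ?\<mu>L ?\<mu>) u g \<longleftrightarrow> holds ?\<mu> (u \<Zsemi> p) g \<and> u \<Zsemi> q = g"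
        using comp_\<mu>[OF \<mu>1(1) u g] \<mu>1(2)[OF u gg(1)[OF g]] gg[OF g] id(2)[OF uq g]
        unfolding p_def q_def by simp
      also have "\<dots> \<longleftrightarrow> (u \<Zsemi> p) \<Zsemi> ?p1 c c = g \<and> (u \<Zsemi> p) \<Zsemi> ?p2 c c = g \<and> u \<Zsemi> q = g"
        using \<mu>_iff[OF up g] by blast
      finally have l: "holds (comp ?M ?\<mu>L ?\<mu>) u g \<longleftrightarrow>
          (u \<Zsemi> p) \<Zsemi> ?p1 c c = g \<and> (u \<Zsemi> p) \<Zsemi> ?p2 c c = g \<and> u \<Zsemi> q = g" .
      have ua1: "(u \<Zsemi> a) \<Zsemi> ?p1 c ?cc = (u \<Zsemi> p) \<Zsemi> ?p1 c c"
        using comp_assoc[OF u a(1) proj_hom(1)[OF c ob(1)]] a(2) comp_assoc[OF u pq(1) pcc(1)] by simp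
      have ua2: "(u \<Zsemi> a) \<Zsemi> ?p2 c ?cc = u \<Zsemi> s"
        using comp_assoc[OF u a(1) proj_hom(2)[OF c ob(1)]] a(3) by simp
      note us = comp_hom[OF u s(1)]
      have us1: "(u \<Zsemi> s) \<Zsemi> ?p1 c c = (u \<Zsemi> p) \<Zsemi> ?p2 c c"
        using comp_assoc[OF u s(1) pcc(1)] s(2) comp_assoc[OF u pq(1) pcc(2)] by simp
      have us2: "(u \<Zsemi> s) \<Zsemi> ?p2 c c = u \<Zsemi> q"
        using comp_assoc[OF u s(1) pcc(2)] s(3) by simp
      have "holds (comp ?M (comp ?M (rel_graph C P a) ?\<mu>R) ?\<mu>) u g \<longleftrightarrow>
          holds ?\<mu>R (u \<Zsemi> a) \<langle>g, g\<rangle>"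
        using comp_\<mu>[OF comp_rel(1)[OF G(1) \<mu>2(1)] u g]
          holds_graph_comp[OF a(1) \<mu>2(1) u gg(1)[OF g]] by simp
      also have "\<dots> \<longleftrightarrow> (u \<Zsemi> p) \<Zsemi> ?p1 c c = g \<and> holds ?\<mu> (u \<Zsemi> s) g"
        using \<mu>2(2)[OF ua gg(1)[OF g]] gg[OF g] ua1 ua2
          id(2)[OF comp_hom[OF up pcc(1)] g] by simp
      also have "\<dots> \<longleftrightarrow> (u \<Zsemi> p) \<Zsemi> ?p1 c c = g \<and> (u \<Zsemi> p) \<Zsemi> ?p2 c c = g \<and> u \<Zsemi> q = g"
        using \<mu>_iff[OF us g] us1 us2 by simp
      finally show "holds (comp ?M ?\<mu>L ?\<mu>) u g \<longleftrightarrow>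
          holds (comp ?M (comp ?M (rel_graph C P a) ?\<mu>R) ?\<mu>) u g" using l by blast
    qed
  qed
  moreover have "comp ?M ?\<eta>L ?\<mu> = left_unitor ?M c"
  proof -
    note pr = proj_hom[OF ob(2) c]
    note G = graph_rel[OF pr(2)]
    have "left_unitor ?M c = rel_graph C P (?p2 ?I c)" by (simp add: Rel_def)
    also have "\<dots> = comp ?M ?\<eta>L ?\<mu>"
    proof (rule rel_eqI[OF G(1) comp_rel(1)[OF \<eta>1(1) \<mu>(1)]])
      fix d u g assume u: "u \<in> hom C d (prod P ?I c)" and g: "g \<in> hom C d c"
      \<comment> \<open>The component in the terminal object imposes no condition, so the composite
        only asks that the second component of \<open>u\<close> be \<open>g\<close>.\<close>
      show "holds (rel_graph C P (?p2 ?I c)) u g \<longleftrightarrow> holds (comp ?M ?\<eta>L ?\<mu>) u g"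
        using comp_\<mu>[OF \<eta>1(1) u g] \<eta>1(2)[OF u gg(1)[OF g]] gg[OF g]
          id(2)[OF comp_hom[OF u pr(2)] g] \<eta>_iff[OF comp_hom[OF u pr(1)] g] G(2)[OF u g] by simp
    qed
    finally show ?thesis by simp
  qed
  moreover have "comp ?M ?\<eta>R ?\<mu> = right_unitor ?M c"
  proof -
    note pr = proj_hom[OF c ob(2)]
    note G = graph_rel[OF pr(1)]
    have "right_unitor ?M c = rel_graph C P (?p1 c ?I)" by (simp add: Rel_def)
    also have "\<dots> = comp ?M ?\<eta>R ?\<mu>"
    proof (rule rel_eqI[OF G(1) comp_rel(1)[OF \<eta>2(1) \<mu>(1)]])
      fix d u g assume u: "u \<in> hom C d (prod P c ?I)" and g: "g \<in> hom C d c"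
      show "holds (rel_graph C P (?p1 c ?I)) u g \<longleftrightarrow> holds (comp ?M ?\<eta>R ?\<mu>) u g"
        using comp_\<mu>[OF \<eta>2(1) u g] \<eta>2(2)[OF u gg(1)[OF g]] gg[OF g]
          id(2)[OF comp_hom[OF u pr(1)] g] \<eta>_iff[OF comp_hom[OF u pr(2)] g] G(2)[OF u g] by simp
    qed
    finally show ?thesis by simp
  qed
  moreover have "comp ?M (symmetry ?M c c) ?\<mu> = ?\<mu>"
  proof -
    define \<sigma> where "\<sigma> = \<langle>?p2 c c, ?p1 c c\<rangle>"
    note \<sigma> = pairing_hom[OF pcc(2,1), folded \<sigma>_def]
    have sym_eq: "symmetry ?M c c = rel_graph C P \<sigma>" by (simp add: Rel_def \<sigma>_def)
    show ?thesis unfolding sym_eq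
    proof (rule rel_eqI[OF comp_rel(1)[OF graph_rel(1)[OF \<sigma>(1)] \<mu>(1)] \<mu>(1)])
      fix d u g assume u: "u \<in> hom C d ?cc" and g: "g \<in> hom C d c"
      have "(u \<Zsemi> \<sigma>) \<Zsemi> ?p1 c c = u \<Zsemi> ?p2 c c" "(u \<Zsemi> \<sigma>) \<Zsemi> ?p2 c c = u \<Zsemi> ?p1 c c"
        using comp_assoc[OF u \<sigma>(1) pcc(1)] comp_assoc[OF u \<sigma>(1) pcc(2)] \<sigma>(2,3) by simp_all
      then show "holds (comp ?M (rel_graph C P \<sigma>) ?\<mu>) u g \<longleftrightarrow> holds ?\<mu> u g"
        using holds_graph_comp[OF \<sigma>(1) \<mu>(1) u g] \<mu>_iff[OF comp_hom[OF u \<sigma>(1)] g] \<mu>_iff[OF u g]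
        by auto
    qed
  qed
  ultimately show ?thesis
    unfolding adjoint_monoid_def comm_monoid_object_def
    using c \<mu>(1) \<eta>(1) right_adjoint_cograph[OF D] right_adjoint_cograph[OF t]
    by (simp add: Rel_simps(1,6,7))
qed

section \<open>Uniqueness: unit and multiplication are determined\<close>

lemma adjoint_monoid_unit:
  assumes "adjoint_monoid (Rel C P) c \<mu> \<eta>" "u \<in> hom C d (terminal P)" "g \<in> hom C d c"
  shows "holds \<eta> u g"
proof -
  have \<eta>: "\<eta> \<in> hom (Rel C P) (terminal P) c" "right_adjoint (Rel C P) \<eta>"
    using assms(1) unfolding adjoint_monoid_def comm_monoid_object_def by (simp_all add: Rel_simps)
  obtain d' e t where e: "regular_epi C e" "e \<in> hom C d' d" and t: "t \<in> hom C d' (terminal P)"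
      "holds \<eta> t (e \<Zsemi> g)"
    using right_adjoint_total[OF \<eta>(2,1) assms(3)] .
  \<comment> \<open>Totality gives some unknown \<open>t\<close>; terminality identifies it with the
    restriction of the prescribed \<open>u\<close>, so that the relation descends.\<close>
  have "t = e \<Zsemi> u" using bang_unique[OF t(1)] comp_hom[OF e(2) assms(2)] by blast
  then show ?thesis using holds_descent[OF \<eta>(1) assms(2,3) e] t(2) by simp
qed

lemma adjoint_monoid_mult:
  assumes M: "adjoint_monoid (Rel C P) c \<mu> \<eta>" and u: "u \<in> hom C d (prod P c c)" and g: "g \<in> hom C d c"
  shows "holds \<mu> u g \<longleftrightarrow> u = \<langle>g, g\<rangle>"
proof -
  let ?I = "terminal P"
  have c: "c \<in> Obj C" using g by (simp add: hom_iff)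
  note id = ident_rel[OF c] and I = terminal_obj
  have \<mu>: "\<mu> \<in> hom (Rel C P) (prod P c c) c" "right_adjoint (Rel C P) \<mu>"
    and \<eta>: "\<eta> \<in> hom (Rel C P) ?I c"
    and unit: "comp (Rel C P) (tensor (Rel C P) \<eta> (ident (Rel C P) c)) \<mu> = rel_graph C P (proj2 P ?I c)"
      "comp (Rel C P) (tensor (Rel C P) (ident (Rel C P) c) \<eta>) \<mu> = rel_graph C P (proj1 P c ?I)"
    using M unfolding adjoint_monoid_def comm_monoid_object_def by (simp_all add: Rel_def)
  note T1 = tensor_rel[OF \<eta> id(1)] and T2 = tensor_rel[OF id(1) \<eta>]
  \<comment> \<open>Stated for every domain, because it is applied on the cover \<open>d'\<close> as
    well as over \<open>d\<close>.\<close>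
  have diag: "u = \<langle>g, g\<rangle>" if u: "u \<in> hom C d (prod P c c)" and g: "g \<in> hom C d c" and h: "holds \<mu> u g"
    for d u g
  proof -
    define x where "x = u \<Zsemi> proj1 P c c"
    define y where "y = u \<Zsemi> proj2 P c c"
    have xy: "x \<in> hom C d c" "y \<in> hom C d c"
      unfolding x_def y_def using comp_hom[OF u] proj_hom[OF c c] by blast+
    have "d \<in> Obj C" using u by (simp add: hom_iff)
    then obtain t where t: "t \<in> hom C d ?I" using bang_exists by blast
    note ty = pairing_hom[OF t xy(2)] and xt = pairing_hom[OF xy(1) t]
    \<comment> \<open>Since \<open>\<eta>\<close> relates \<open>t\<close> to any \<open>x\<close>
      whatsoever, \<open>\<eta> \<otimes> \<one> c\<close> relates
      \<open>\<langle>t, y\<rangle>\<close> to \<open>u\<close>, and \<open>\<mu>\<close> relates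
      \<open>u\<close> to \<open>g\<close>. The left unit law identifies this composite with the
      graph of the second projection, hence \<open>y = g\<close>. The right unit law treats
      \<open>x\<close> symmetrically.\<close>
    have "holds (tensor (Rel C P) \<eta> (ident (Rel C P) c)) \<langle>t, y\<rangle> u"
      using T1(2)[OF ty(1) u] ty(2,3) adjoint_monoid_unit[OF M t xy(1)] id(2)[OF xy(2) xy(2)]
      unfolding x_def y_def by simp
    from comp_relI[OF T1(1) \<mu>(1) ty(1) u g this h] have "y = g"
      unfolding unit using graph_rel(2)[OF proj_hom(2)[OF I c] ty(1) g] ty(3) by simp
    moreover have "holds (tensor (Rel C P) (ident (Rel C P) c) \<eta>) \<langle>x, t\<rangle> u"
      using T2(2)[OF xt(1) u] xt(2,3) adjoint_monoid_unit[OF M t xy(2)] id(2)[OF xy(1) xy(1)]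
      unfolding x_def y_def by simp
    from comp_relI[OF T2(1) \<mu>(1) xt(1) u g this h] have "x = g"
      unfolding unit using graph_rel(2)[OF proj_hom(1)[OF c I] xt(1) g] xt(2) by simp
    ultimately show ?thesis using eq_pairing_iff[OF u g g] unfolding x_def y_def by simp
  qed
  obtain d' e w where e: "regular_epi C e" "e \<in> hom C d' d" and w: "w \<in> hom C d' (prod P c c)"
      "holds \<mu> w (e \<Zsemi> g)"
    using right_adjoint_total[OF \<mu>(2,1) g] .
  \<comment> \<open>The local preimage \<open>w\<close> is diagonal, hence the restriction along
    \<open>e\<close> of \<open>\<langle>g, g\<rangle>\<close>, an arrow defined over
    \<open>d\<close> itself; this is what permits descent.\<close>
  have "w = e \<Zsemi> \<langle>g, g\<rangle>"
    using diag[OF w(1) comp_hom[OF e(2) g] w(2)] comp_pairing[OF e(2) g g] by simp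
  then have "holds \<mu> \<langle>g, g\<rangle> g"
    using holds_descent[OF \<mu>(1) pairing_hom(1)[OF g g] g e] w(2) by simp
  then show ?thesis using diag[OF u g] by blast
qed

lemma adjoint_monoid_unique:
  assumes "adjoint_monoid (Rel C P) c \<mu> \<eta>" "adjoint_monoid (Rel C P) c \<mu>' \<eta>'"
  shows "\<mu> = \<mu>'" "\<eta> = \<eta>'"
proof -
  have hom: "\<mu> \<in> hom (Rel C P) (prod P c c) c" "\<eta> \<in> hom (Rel C P) (terminal P) c"
      "\<mu>' \<in> hom (Rel C P) (prod P c c) c" "\<eta>' \<in> hom (Rel C P) (terminal P) c"
    using assms unfolding adjoint_monoid_def comm_monoid_object_def by (simp_all add: Rel_simps)
  show "\<mu> = \<mu>'"
    by (rule rel_eqI[OF hom(1,3)])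
      (simp add: adjoint_monoid_mult[OF assms(1)] adjoint_monoid_mult[OF assms(2)])
  show "\<eta> = \<eta>'"
    by (rule rel_eqI[OF hom(2,4)])
      (simp add: adjoint_monoid_unit[OF assms(1)] adjoint_monoid_unit[OF assms(2)])
qed

end

theorem proposition3p9:
  fixes C :: "('o, 'm) category_data" and P :: "('o, 'm) products_data"
  assumes "regular_category C" and "chosen_products C P"
    and "r \<in> Obj (Rel C P)"
  shows "\<exists>!m. case m of (\<mu>, \<eta>) \<Rightarrow> adjoint_monoid (Rel C P) r \<mu> \<eta>"
proof -
  interpret regular_category_with_products C P
    using assms(1,2) by (simp add: regular_category_with_products_def
        regular_category_with_products_axioms_def)
  have r: "r \<in> Obj C" using assms(3) by (simp add: Rel_simps)
  then obtain t where t: "t \<in> hom C r (terminal P)" using bang_exists by blast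
  show ?thesis
  proof (rule ex1I)
    show "case (cograph (pair (ident C r) (ident C r)), cograph t) of
        (\<mu>, \<eta>) \<Rightarrow> adjoint_monoid (Rel C P) r \<mu> \<eta>"
      using adjoint_monoid_exists[OF r t] by simp
    fix m assume "case m of (\<mu>, \<eta>) \<Rightarrow> adjoint_monoid (Rel C P) r \<mu> \<eta>"
    then show "m = (cograph (pair (ident C r) (ident C r)), cograph t)"
      using adjoint_monoid_unique[OF _ adjoint_monoid_exists[OF r t]] by (cases m) auto
  qed
qed

end
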